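(* For all positive integers $k,d$ and all $n$, there exists a bounded-error quantum algorithm that solves the exact gap group testing (EGGT) problem with parameters $k$ and $d$ using $O\big(\sqrt{1+k/d}\big)$ queries.
   Context: Let $[n]=\{1,\dots,n\}$. For $A\subseteq[n]$ define $\mathrm{Intersects}_A:2^{[n]}\to\{0,1\}$ by $\mathrm{Intersects}_A(S)=1$ if $A\cap S\neq\emptyset$ and $0$ otherwise. Let $\mathcal X$ be the family of subsets of $[n]$ of size exactly $k$ and $\mathcal Y$ those of size exactly $k+d$. In EGGT one is given oracle access to $\mathrm{Intersects}_A$ with $A\in\mathcal X\cup\mathcal Y$ and must decide whether $A\in\mathcal X$ or $A\in\mathcal Y$. A quantum query algorithm alternates input-independent unitaries with the oracle acting as $|S\rangle\mapsto(-1)^{\mathrm{Intersects}_A(S)}|S\rangle$ on an $n$-qubit register holding $S$ (tensored with identity on workspace); bounded error means correct with probability at least $2/3$ on every allowed input. *)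

theory Defs
  imports
    Complex_Main
    "HOL-Library.Nat_Bijection"
    "Jordan_Normal_Form.Schur_Decomposition"
begin

definition intersects :: "nat set \<Rightarrow> nat set \<Rightarrow> nat" where
  "intersects A S = (if A \<inter> S \<noteq> {} then 1 else 0)"

definition size_family :: "nat \<Rightarrow> nat \<Rightarrow> nat set set" where
  "size_family n s = {A. A \<subseteq> {1..n} \<and> card A = s}"

text \<open>
  The state space is the tensor product of an n-qubit register with an m-dimensional workspace.
  It has dimension \<open>2 ^ n * m\<close>, and the basis vector \<open>|S\<rangle> \<otimes> |w\<rangle>\<close> has index \<open>s * m + w\<close>, where
  the binary digits of \<open>s\<close> are the indicator vector of \<open>S\<close>: digit \<open>i - 1\<close> says whether \<open>i \<in> S\<close>.
\<close>

definition register_set :: "nat \<Rightarrow> nat set" where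
  "register_set s = Suc ` set_decode s"

lemma bij_betw_register_set: "bij_betw register_set {..<2 ^ n} (Pow {1..n})"
proof -
  have dec: "bij_betw set_decode {..<2 ^ n} (Pow {..<n})"
  proof (rule bij_betw_byWitness[where f' = set_encode])
    show "set_decode ` {..<2 ^ n} \<subseteq> Pow {..<n}"
    proof (clarsimp simp: set_decode_def)
      fix s i :: nat
      assume s: "s < 2 ^ n" and o: "odd (s div 2 ^ i)"
      show "i < n"
      proof (rule ccontr)
        assume "\<not> i < n"
        then have "(2::nat) ^ n \<le> 2 ^ i" by simp
        with s have "s < 2 ^ i" by linarith
        then have "s div 2 ^ i = 0" by (rule div_less)
        with o show False by simp
      qed
    qed
    show "set_encode ` Pow {..<n} \<subseteq> {..<2 ^ n}"
    proof clarsimp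
      fix B :: "nat set"
      assume B: "B \<subseteq> {..<n}"
      have "set_encode B \<le> (\<Sum>i<n. 2 ^ i)"
        unfolding set_encode_def by (rule sum_mono2) (use B in auto)
      also have "\<dots> < 2 ^ n"
        by (induction n) auto
      finally show "set_encode B < 2 ^ n" .
    qed
  qed (auto simp: finite_subset[OF _ finite_lessThan])
  have suc: "bij_betw ((`) Suc) (Pow {..<n}) (Pow {1..n})"
    by (rule bij_betw_Pow) (auto simp: bij_betw_def image_Suc_lessThan)
  show ?thesis
    using bij_betw_trans[OF dec suc] by (simp add: register_set_def o_def cong: bij_betw_cong)
qed

definition phase_oracle :: "nat \<Rightarrow> nat \<Rightarrow> (nat set \<Rightarrow> nat) \<Rightarrow> complex mat" where
  "phase_oracle n m f =
     mat (2 ^ n * m) (2 ^ n * m)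
       (\<lambda>(i, j). if i = j then (- 1) ^ f (register_set (j div m)) else 0)"

definition unitary_matrix :: "nat \<Rightarrow> complex mat \<Rightarrow> bool" where
  "unitary_matrix N U \<longleftrightarrow> U \<in> carrier_mat N N \<and> mat_adjoint U * U = 1\<^sub>m N"

text \<open>
  An algorithm applies \<open>initial_unitary\<close> to the basis vector \<open>|{}\<rangle> \<otimes> |0\<rangle>\<close> and then, for each element
  of \<open>later_unitaries\<close>, makes one query and applies that unitary. The final state is measured in
  the computational basis, and the observed basis index \<open>j\<close> is answered by \<open>answer j\<close>.
\<close>

record query_algorithm =
  workspace_dim :: nat
  initial_unitary :: "complex mat"
  later_unitaries :: "complex mat list"
  answer :: "nat \<Rightarrow> bool"

definition state_dim :: "nat \<Rightarrow> query_algorithm \<Rightarrow> nat" where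
  "state_dim n Q = 2 ^ n * workspace_dim Q"

definition quantum_query_algorithm :: "nat \<Rightarrow> query_algorithm \<Rightarrow> bool" where
  "quantum_query_algorithm n Q \<longleftrightarrow>
     workspace_dim Q > 0 \<and>
     unitary_matrix (state_dim n Q) (initial_unitary Q) \<and>
     (\<forall>U \<in> set (later_unitaries Q). unitary_matrix (state_dim n Q) U)"

definition num_queries :: "query_algorithm \<Rightarrow> nat" where
  "num_queries Q = length (later_unitaries Q)"

definition final_state :: "nat \<Rightarrow> query_algorithm \<Rightarrow> (nat set \<Rightarrow> nat) \<Rightarrow> complex vec" where
  "final_state n Q f =
     foldl (\<lambda>\<psi> U. U *\<^sub>v (phase_oracle n (workspace_dim Q) f *\<^sub>v \<psi>))
       (initial_unitary Q *\<^sub>v unit_vec (state_dim n Q) 0)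
       (later_unitaries Q)"

definition answer_prob ::
    "nat \<Rightarrow> query_algorithm \<Rightarrow> (nat set \<Rightarrow> nat) \<Rightarrow> bool \<Rightarrow> real" where
  "answer_prob n Q f b =
     (\<Sum>j | j < state_dim n Q \<and> answer Q j = b. (cmod (final_state n Q f $ j))\<^sup>2)"

text \<open>Answer \<open>False\<close> stands for size \<open>k\<close>, answer \<open>True\<close> for size \<open>k + d\<close>.\<close>

definition solves_EGGT :: "nat \<Rightarrow> nat \<Rightarrow> nat \<Rightarrow> query_algorithm \<Rightarrow> bool" where
  "solves_EGGT n k d Q \<longleftrightarrow>
     (\<forall>A \<in> size_family n k. answer_prob n Q (intersects A) False \<ge> 2 / 3) \<and>
     (\<forall>A \<in> size_family n (k + d). answer_prob n Q (intersects A) True \<ge> 2 / 3)"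

end

theory Submission
  imports Defs
begin

text \<open>
  Let U = R Z O with O the query, Z a fixed diagonal sign matrix and R a fixed reflection, arranged so that,
  with e the start vector: for size k there is a fixed vector of U close to e; for size k + d one has
  2 e = \<open>\<eta>\<close> - U \<open>\<eta>\<close> with a short \<open>\<eta>\<close>. Then the average of U^t e over t < T
  stays near e in the first case, and telescopes to norm at most \<open>\<parallel>\<eta>\<parallel> / T\<close> in the second.

  R is the reflection about the span of the vectors \<open>e + \<epsilon> a\<^sub>A\<close> with |A| = k, so all that is needed are
  vectors \<open>a\<^sub>A\<close>, \<open>b\<^sub>B\<close> in the eigenspaces of Z O for the eigenvalues 1 and -1 respectively, whose inner
  product is the same for all A and B, and whose squared lengths are of order \<open>sqrt (1 + k / d)\<close>. Let S be
  random with each element outside S with probability q. The amplitudes [A misses S] and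
  \<open>x ^ |B \<inter> S|\<close> [B meets S] have inner product \<open>q ^ |A| ((q + (1 - q) x) ^ r - q ^ r)\<close>, r = |B - A|.
  Choosing x so that q + (1 - q) x is the next larger value of q on a grid \<open>q\<^sub>L < \<dots> < q\<^sub>0 = 1\<close>, the sum over
  the grid of these products, each divided by \<open>q ^ |A|\<close>, telescopes to \<open>1 - q\<^sub>L ^ |B - A|\<close>.
  Subtracting \<open>q\<^sub>L ^ d\<close> times the same expression with A and B exchanged gives \<open>1 - q\<^sub>L ^ d\<close>, because |B - A| = |A - B| + d. The grid \<open>q\<^sub>i = 1 - i\<^sup>2 / (2 (k + d))\<close> is
  the one in which every level contributes O(1) to the squared lengths; L of order \<open>sqrt (1 + k / d)\<close>
  levels bring \<open>1 - q\<^sub>L ^ d\<close> up to a constant.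
\<close>

section \<open>Unitary matrices and reflections\<close>

lemma cscalar_prod_sum:
  fixes x y :: "complex vec"
  assumes "y \<in> carrier_vec N"
  shows "x \<bullet>c y = (\<Sum>i<N. x $ i * cnj (y $ i))"
  using assms by (auto simp: scalar_prod_def lessThan_atLeast0 intro!: sum.cong)

lemma cnj_cscalar_prod:
  fixes x y :: "complex vec"
  assumes "x \<in> carrier_vec N" "y \<in> carrier_vec N"
  shows "cnj (x \<bullet>c y) = y \<bullet>c x"
  using assms by (simp add: cscalar_prod_sum[of _ N] mult.commute)

lemma cscalar_prod_linear:
  fixes x y z :: "complex vec"
  assumes xyz: "x \<in> carrier_vec N" "y \<in> carrier_vec N" "z \<in> carrier_vec N"
  shows "(a \<cdot>\<^sub>v x + b \<cdot>\<^sub>v y) \<bullet>c z = a * (x \<bullet>c z) + b * (y \<bullet>c z)"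
    and "z \<bullet>c (a \<cdot>\<^sub>v x + b \<cdot>\<^sub>v y) = cnj a * (z \<bullet>c x) + cnj b * (z \<bullet>c y)"
proof -
  show "(a \<cdot>\<^sub>v x + b \<cdot>\<^sub>v y) \<bullet>c z = a * (x \<bullet>c z) + b * (y \<bullet>c z)"
    using xyz by (simp add: add_scalar_prod_distrib[of _ N])
  have *: "a \<cdot>\<^sub>v x + b \<cdot>\<^sub>v y \<in> carrier_vec N" using xyz by simp
  show "z \<bullet>c (a \<cdot>\<^sub>v x + b \<cdot>\<^sub>v y) = cnj a * (z \<bullet>c x) + cnj b * (z \<bullet>c y)"
    unfolding cscalar_prod_sum[OF *] cscalar_prod_sum[OF xyz(1)] cscalar_prod_sum[OF xyz(2)]
      sum_distrib_left sum.distrib[symmetric]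
    by (rule sum.cong) (use xyz in \<open>auto simp: algebra_simps\<close>)
qed

lemma cscalar_prod_unit:
  fixes x :: "complex vec"
  assumes "x \<in> carrier_vec N" "i < N"
  shows "x \<bullet>c unit_vec N i = x $ i"
  using assms by (simp add: cscalar_prod_sum[of _ N] if_distrib[of cnj] if_distrib[of "\<lambda>c. _ * c"] cong: if_cong)

definition norm_sq :: "complex vec \<Rightarrow> real" where
  "norm_sq v = (\<Sum>i<dim_vec v. (cmod (v $ i))\<^sup>2)"

lemma cscalar_prod_self: "v \<bullet>c v = of_real (norm_sq v)"
proof -
  have "v \<bullet>c v = (\<Sum>i<dim_vec v. v $ i * cnj (v $ i))"
    by (rule cscalar_prod_sum) simp
  also have "\<dots> = of_real (norm_sq v)"
    unfolding norm_sq_def of_real_sum complex_norm_square ..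
  finally show ?thesis .
qed

lemma norm_sq_nonneg: "norm_sq v \<ge> 0"
  by (simp add: norm_sq_def sum_nonneg)

lemma cmod_component_le_norm_sq:
  assumes "i < dim_vec v"
  shows "(cmod (v $ i))\<^sup>2 \<le> norm_sq v"
  unfolding norm_sq_def by (rule member_le_sum) (use assms in auto)

text \<open>The triangle inequality in squared form. It already holds in each component, so it only
  has to be summed and Cauchy-Schwarz is avoided.\<close>

lemma norm_sq_minus_le:
  assumes "x \<in> carrier_vec N" "y \<in> carrier_vec N"
  shows "norm_sq (x - y) \<le> 2 * norm_sq x + 2 * norm_sq y"
proof -
  have *: "(cmod (a - b))\<^sup>2 \<le> 2 * (cmod a)\<^sup>2 + 2 * (cmod b)\<^sup>2" for a b
  proof -
    have "(cmod (a - b))\<^sup>2 \<le> (cmod a + cmod b)\<^sup>2"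
      by (intro power_mono norm_triangle_ineq4) auto
    also have "\<dots> \<le> 2 * (cmod a)\<^sup>2 + 2 * (cmod b)\<^sup>2"
      using sum_squares_bound[of "cmod a" "cmod b"] by (simp add: power2_sum)
    finally show ?thesis .
  qed
  have "norm_sq (x - y) = (\<Sum>i<N. (cmod (x $ i - y $ i))\<^sup>2)"
    using assms by (simp add: norm_sq_def)
  also have "\<dots> \<le> (\<Sum>i<N. 2 * (cmod (x $ i))\<^sup>2 + 2 * (cmod (y $ i))\<^sup>2)"
    using * by (rule sum_mono)
  also have "\<dots> = 2 * norm_sq x + 2 * norm_sq y"
    using assms by (simp add: norm_sq_def sum_distrib_left sum.distrib)
  finally show ?thesis .
qed

lemma norm_sq_minus_unit:
  assumes x: "x \<in> carrier_vec N" and i: "i < N"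
  shows "norm_sq (x - unit_vec N i) = norm_sq x - 2 * Re (x $ i) + 1"
proof -
  have "norm_sq (x - unit_vec N i) = (cmod (x $ i - 1))\<^sup>2 + (\<Sum>j\<in>{..<N} - {i}. (cmod (x $ j))\<^sup>2)"
    using x i by (auto simp: norm_sq_def sum.remove[of _ i] intro!: sum.cong)
  moreover have "norm_sq x = (cmod (x $ i))\<^sup>2 + (\<Sum>j\<in>{..<N} - {i}. (cmod (x $ j))\<^sup>2)"
    using x i by (simp add: norm_sq_def sum.remove[of _ i])
  moreover have "(cmod (x $ i - 1))\<^sup>2 = (cmod (x $ i))\<^sup>2 - 2 * Re (x $ i) + 1"
    unfolding cmod_power2 by (simp add: power2_eq_square algebra_simps)
  ultimately show ?thesis by simp
qed

text \<open>Entry (i, j) of \<open>mat_adjoint U * U\<close> is the inner product of the images of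
  the basis vectors j and i. The isometry form is the convenient one for products, diagonal
  matrices, block matrices and reflections.\<close>

lemma unitary_matrix_iff_isometry:
  assumes U: "U \<in> carrier_mat N N"
  shows "unitary_matrix N U \<longleftrightarrow>
    (\<forall>x \<in> carrier_vec N. \<forall>y \<in> carrier_vec N. (U *\<^sub>v x) \<bullet>c (U *\<^sub>v y) = x \<bullet>c y)"
proof -
  have entry: "(mat_adjoint U * U) $$ (i, j) = (\<Sum>k<N. cnj (U $$ (k, i)) * U $$ (k, j))"
    if "i < N" "j < N" for i j
    using U that by (auto simp: mat_adjoint_def scalar_prod_def lessThan_atLeast0 intro!: sum.cong)
  have dim: "mat_adjoint U * U \<in> carrier_mat N N"
    using U by (auto simp: mat_adjoint_def)
  show ?thesis
  proof
    assume uni: "unitary_matrix N U"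
    then have d: "(\<Sum>k<N. cnj (U $$ (k, i)) * U $$ (k, j)) = (if i = j then 1 else 0)"
      if "i < N" "j < N" for i j
      using entry[OF that] that by (simp add: unitary_matrix_def)
    show "\<forall>x \<in> carrier_vec N. \<forall>y \<in> carrier_vec N. (U *\<^sub>v x) \<bullet>c (U *\<^sub>v y) = x \<bullet>c y"
    proof (intro ballI)
      fix x y :: "complex vec"
      assume x: "x \<in> carrier_vec N" and y: "y \<in> carrier_vec N"
      have "(U *\<^sub>v x) \<bullet>c (U *\<^sub>v y)
          = (\<Sum>k<N. (\<Sum>j<N. U $$ (k, j) * x $ j) * cnj (\<Sum>i<N. U $$ (k, i) * y $ i))"
        using U x y by (subst cscalar_prod_sum[of _ N])
          (auto simp: scalar_prod_def lessThan_atLeast0 intro!: sum.cong)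
      also have "\<dots> = (\<Sum>k<N. \<Sum>j<N. \<Sum>i<N. cnj (U $$ (k, i)) * U $$ (k, j) * (x $ j * cnj (y $ i)))"
        by (simp add: sum_product mult_ac)
      also have "\<dots> = (\<Sum>j<N. \<Sum>k<N. \<Sum>i<N. cnj (U $$ (k, i)) * U $$ (k, j) * (x $ j * cnj (y $ i)))"
        by (rule sum.swap)
      also have "\<dots> = (\<Sum>j<N. \<Sum>i<N. \<Sum>k<N. cnj (U $$ (k, i)) * U $$ (k, j) * (x $ j * cnj (y $ i)))"
        by (intro sum.cong refl sum.swap)
      also have "\<dots> = (\<Sum>j<N. \<Sum>i<N. (if i = j then 1 else 0) * (x $ j * cnj (y $ i)))"
        by (intro sum.cong refl) (simp add: sum_distrib_right[symmetric] d)
      also have "\<dots> = x \<bullet>c y"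
        using y by (auto simp: cscalar_prod_sum[of _ N] if_distrib[of "\<lambda>c. c * _"] cong: if_cong)
      finally show "(U *\<^sub>v x) \<bullet>c (U *\<^sub>v y) = x \<bullet>c y" .
    qed
  next
    assume iso: "\<forall>x \<in> carrier_vec N. \<forall>y \<in> carrier_vec N. (U *\<^sub>v x) \<bullet>c (U *\<^sub>v y) = x \<bullet>c y"
    have "mat_adjoint U * U = 1\<^sub>m N"
    proof (rule eq_matI)
      fix i j assume "i < dim_row (1\<^sub>m N)" "j < dim_col (1\<^sub>m N)"
      then have ij: "i < N" "j < N" by auto
      have col: "(U *\<^sub>v unit_vec N j) $ k = U $$ (k, j)" if "k < N" "j < N" for k j
        using U that by (auto simp: scalar_prod_def if_distrib[of "\<lambda>c. _ * c"] cong: if_cong)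
      have "(U *\<^sub>v unit_vec N j) \<bullet>c (U *\<^sub>v unit_vec N i) = (\<Sum>k<N. cnj (U $$ (k, i)) * U $$ (k, j))"
        using U ij by (subst cscalar_prod_sum[of _ N]) (auto simp: col simp del: index_mult_mat_vec intro!: sum.cong)
      moreover have "unit_vec N j \<bullet>c unit_vec N i = (1\<^sub>m N $$ (i, j) :: complex)"
        using ij by (subst cscalar_prod_unit) auto
      ultimately show "(mat_adjoint U * U) $$ (i, j) = 1\<^sub>m N $$ (i, j)"
        using iso ij entry by simp
    qed (use dim in auto)
    with U show "unitary_matrix N U" by (simp add: unitary_matrix_def)
  qed
qed

lemma unitary_matrix_carrier: "unitary_matrix N U \<Longrightarrow> U \<in> carrier_mat N N"
  by (simp add: unitary_matrix_def)

lemma unitary_cscalar_prod: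
  assumes "unitary_matrix N U" "x \<in> carrier_vec N" "y \<in> carrier_vec N"
  shows "(U *\<^sub>v x) \<bullet>c (U *\<^sub>v y) = x \<bullet>c y"
  using assms unitary_matrix_iff_isometry[OF unitary_matrix_carrier[OF assms(1)]] by simp

lemma unitary_norm_sq:
  assumes "unitary_matrix N U" "x \<in> carrier_vec N"
  shows "norm_sq (U *\<^sub>v x) = norm_sq x"
  using unitary_cscalar_prod[OF assms assms(2)] by (simp add: cscalar_prod_self)

lemma unitary_matrix_mult:
  assumes "unitary_matrix N U" "unitary_matrix N V"
  shows "unitary_matrix N (U * V)"
proof -
  have c: "U \<in> carrier_mat N N" "V \<in> carrier_mat N N"
    using assms by (auto simp: unitary_matrix_def)
  show ?thesis
    using c assms by (subst unitary_matrix_iff_isometry) (auto simp: unitary_cscalar_prod)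
qed

lemma unitary_matrix_one: "unitary_matrix N (1\<^sub>m N)"
  by (simp add: unitary_matrix_iff_isometry)

definition diag_matrix :: "nat \<Rightarrow> (nat \<Rightarrow> complex) \<Rightarrow> complex mat" where
  "diag_matrix N g = mat N N (\<lambda>(i, j). if i = j then g i else 0)"

lemma diag_matrix_carrier [simp]: "diag_matrix N g \<in> carrier_mat N N"
  by (simp add: diag_matrix_def)

lemma diag_matrix_mult_vec:
  assumes "v \<in> carrier_vec N"
  shows "diag_matrix N g *\<^sub>v v = vec N (\<lambda>i. g i * v $ i)"
  using assms by (auto simp: diag_matrix_def scalar_prod_def if_distrib[of "\<lambda>c. c * _"] cong: if_cong)

lemma unitary_diag_matrix:
  assumes "\<And>i. i < N \<Longrightarrow> cmod (g i) = 1"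
  shows "unitary_matrix N (diag_matrix N g)"
proof -
  have "g i * x * (cnj (g i) * y) = x * y" if "i < N" for i x y
    using assms[OF that] complex_norm_square[of "g i"] by (simp add: algebra_simps)
  then show ?thesis
    by (auto simp: unitary_matrix_iff_isometry diag_matrix_mult_vec cscalar_prod_sum[of _ N] intro!: sum.cong)
qed

lemma phase_oracle_diag:
  "phase_oracle n m f = diag_matrix (2 ^ n * m) (\<lambda>i. (- 1) ^ f (register_set (i div m)))"
  by (auto simp: phase_oracle_def diag_matrix_def intro!: eq_matI)

lemma unitary_phase_oracle: "unitary_matrix (2 ^ n * m) (phase_oracle n m f)"
  unfolding phase_oracle_diag by (rule unitary_diag_matrix) (simp add: norm_power)

section \<open>Orthogonal projections and reflections\<close>

text \<open>Gram-Schmidt by induction on the list: a new vector adds the rank-one projection onto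
  its component orthogonal to the earlier ones. That \<open>P\<close> kills everything orthogonal to
  \<open>vs\<close> keeps its range inside their span, and gives the reflection built from it the
  sign -1 there.\<close>

lemma exists_projection:
  assumes "set vs \<subseteq> carrier_vec N"
  shows "\<exists>P \<in> carrier_mat N N.
    (\<forall>x \<in> carrier_vec N. P *\<^sub>v (P *\<^sub>v x) = P *\<^sub>v x) \<and>
    (\<forall>x \<in> carrier_vec N. \<forall>y \<in> carrier_vec N. (P *\<^sub>v x) \<bullet>c y = x \<bullet>c (P *\<^sub>v y)) \<and>
    (\<forall>v \<in> set vs. P *\<^sub>v v = v) \<and>
    (\<forall>x \<in> carrier_vec N. (\<forall>v \<in> set vs. x \<bullet>c v = (0::complex)) \<longrightarrow> P *\<^sub>v x = 0\<^sub>v N)"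
  using assms
proof (induction vs)
  case Nil
  have "0\<^sub>m N N *\<^sub>v x = 0\<^sub>v N" if "x \<in> carrier_vec N" for x :: "complex vec"
    using that by (intro eq_vecI) auto
  then show ?case
    by (intro bexI[of _ "0\<^sub>m N N"]) (auto simp: cscalar_prod_sum[of _ N])
next
  case (Cons v vs)
  then obtain P where P: "P \<in> carrier_mat N N"
    and idem: "\<And>x. x \<in> carrier_vec N \<Longrightarrow> P *\<^sub>v (P *\<^sub>v x) = P *\<^sub>v x"
    and sa: "\<And>x y. x \<in> carrier_vec N \<Longrightarrow> y \<in> carrier_vec N \<Longrightarrow> (P *\<^sub>v x) \<bullet>c y = x \<bullet>c (P *\<^sub>v y)"
    and fix_vs: "\<And>u. u \<in> set vs \<Longrightarrow> P *\<^sub>v u = u"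
    and kill: "\<And>x. x \<in> carrier_vec N \<Longrightarrow> (\<forall>u \<in> set vs. x \<bullet>c u = 0) \<Longrightarrow> P *\<^sub>v x = 0\<^sub>v N"
    and v: "v \<in> carrier_vec N" and vs: "set vs \<subseteq> carrier_vec N"
    by auto
  define u where "u = P *\<^sub>v v"
  define w where "w = v - u"
  have u: "u \<in> carrier_vec N" and w: "w \<in> carrier_vec N"
    using P v by (auto simp: u_def w_def)
  have v_eq: "v = 1 \<cdot>\<^sub>v u + 1 \<cdot>\<^sub>v w" and w_eq: "w = 1 \<cdot>\<^sub>v v + (-1) \<cdot>\<^sub>v u"
    using u v by (auto simp: w_def)
  have Pu: "P *\<^sub>v u = u"
    using idem[OF v] by (simp add: u_def)
  have Pw: "P *\<^sub>v w = 0\<^sub>v N"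
    using P v u Pu u_def[symmetric] by (simp add: w_def mult_minus_distrib_mat_vec)
  show ?case
  \<comment> \<open>If no orthogonal component is left, \<open>v\<close> already lies in the range
    of \<open>P\<close>.\<close>
  proof (cases "w = 0\<^sub>v N")
    case True
    have "P *\<^sub>v v = v"
      using v_eq u True Pu by simp
    then show ?thesis
      using P idem sa fix_vs kill by (intro bexI[of _ P] conjI ballI impI) (auto simp del: index_mult_mat_vec)
  next
    case False
    define r where "r = w \<bullet>c w"
    have r: "r \<noteq> 0"
      using False conjugate_square_eq_0_vec[OF w] by (simp add: r_def)
    have r_real: "cnj r = r" by (simp add: r_def cscalar_prod_self)
    \<comment> \<open>\<open>W\<close> divided by \<open>r\<close> is the orthogonal projection onto
      the line of \<open>w\<close>, a line orthogonal to the range of \<open>P\<close>.\<close>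
    define W where "W = mat N N (\<lambda>(i, j). w $ i * cnj (w $ j))"
    have W: "W \<in> carrier_mat N N" by (simp add: W_def)
    have Wx: "W *\<^sub>v x = (x \<bullet>c w) \<cdot>\<^sub>v w" if x: "x \<in> carrier_vec N" for x
    proof (rule eq_vecI)
      fix i assume "i < dim_vec ((x \<bullet>c w) \<cdot>\<^sub>v w)"
      then have "i < N" using w by simp
      then show "(W *\<^sub>v x) $ i = ((x \<bullet>c w) \<cdot>\<^sub>v w) $ i"
        using w x by (simp add: W_def scalar_prod_def cscalar_prod_sum[of _ N] lessThan_atLeast0
            sum_distrib_left mult_ac)
    qed (use W w in auto)
    define P' where "P' = P + (1 / r) \<cdot>\<^sub>m W"
    have P': "P' \<in> carrier_mat N N" using P W by (simp add: P'_def)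
    have P'x: "P' *\<^sub>v x = 1 \<cdot>\<^sub>v (P *\<^sub>v x) + ((x \<bullet>c w) / r) \<cdot>\<^sub>v w" if x: "x \<in> carrier_vec N" for x
    proof -
      have "((1 / r) \<cdot>\<^sub>m W) *\<^sub>v x = (1 / r) \<cdot>\<^sub>v (W *\<^sub>v x)"
        using W x by auto
      then show ?thesis
        using P W x w by (simp add: P'_def add_mult_distrib_mat_vec Wx smult_smult_assoc)
    qed
    have Px: "P *\<^sub>v x \<in> carrier_vec N" if "x \<in> carrier_vec N" for x using P that by simp
    have Pxw: "(P *\<^sub>v x) \<bullet>c w = 0" if x: "x \<in> carrier_vec N" for x
      using sa[OF x w] Pw x by simp
    have lin: "P' *\<^sub>v (a \<cdot>\<^sub>v x + b \<cdot>\<^sub>v y) = a \<cdot>\<^sub>v (P' *\<^sub>v x) + b \<cdot>\<^sub>v (P' *\<^sub>v y)"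
      if "x \<in> carrier_vec N" "y \<in> carrier_vec N" for a b x y
      using P' that by (simp add: mult_add_distrib_mat_vec mult_mat_vec)
    have w0: "0 \<cdot>\<^sub>v w = 0\<^sub>v N" "1 \<cdot>\<^sub>v w = w"
      using w by auto
    have P'P: "P' *\<^sub>v (P *\<^sub>v x) = P *\<^sub>v x" if x: "x \<in> carrier_vec N" for x
      using P'x[OF Px[OF x]] idem[OF x] Pxw[OF x] Px[OF x] by (simp add: w0 del: mult_mat_vec_carrier)
    have P'w: "P' *\<^sub>v w = w"
      using P'x[OF w] Pw w r by (simp add: r_def[symmetric] w0)
    have vw: "v \<bullet>c w = r"
      using cscalar_prod_linear(1)[OF u w w, of 1 1] Pxw[OF v]
      unfolding v_eq[symmetric] by (simp add: u_def r_def)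
    have 1: "P' *\<^sub>v (P' *\<^sub>v x) = P' *\<^sub>v x" if x: "x \<in> carrier_vec N" for x
      using lin[OF Px[OF x] w, of 1 "x \<bullet>c w / r"] by (simp add: P'x[OF x] P'P[OF x] P'w)
    have 2: "(P' *\<^sub>v x) \<bullet>c y = x \<bullet>c (P' *\<^sub>v y)"
      if x: "x \<in> carrier_vec N" and y: "y \<in> carrier_vec N" for x y
      using cscalar_prod_linear(1)[OF Px[OF x] w y, of 1 "x \<bullet>c w / r"]
        cscalar_prod_linear(2)[OF Px[OF y] w x, of 1 "y \<bullet>c w / r"] sa[OF x y]
        cnj_cscalar_prod[OF y w]
      by (simp add: P'x x y r_real mult.commute)
    have 3: "P' *\<^sub>v z = z" if z: "z \<in> set (v # vs)" for z
    proof (cases "z = v")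
      case True
      then show ?thesis using P'x[OF v, unfolded vw u_def[symmetric]] r v_eq by simp
    next
      case False
      with z have z': "z \<in> set vs" "z \<in> carrier_vec N" using vs by auto
      then show ?thesis using P'P[OF z'(2)] fix_vs by simp
    qed
    have 4: "P' *\<^sub>v x = 0\<^sub>v N" if x: "x \<in> carrier_vec N" and perp: "\<forall>u \<in> set (v # vs). x \<bullet>c u = 0" for x
    proof -
      have Px0: "P *\<^sub>v x = 0\<^sub>v N" using kill[OF x] perp by simp
      have "x \<bullet>c u = 0" using sa[OF x v] Px0 v by (simp add: u_def)
      then have "x \<bullet>c w = 0"
        using cscalar_prod_linear(2)[OF v u x, of 1 "-1"] perp unfolding w_eq[symmetric] by simp
      then show ?thesis using P'x[OF x] Px0 by (simp add: w0)
    qed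
    show ?thesis
      by (rule bexI[of _ P'], intro conjI ballI impI)
        (erule 1, erule (1) 2, erule 3, erule (1) 4, rule P')
  qed
qed

text \<open>Take 2 P - 1 for the projection \<open>P\<close> onto the span: it is 1 on the range of
  \<open>P\<close> and -1 on the kernel, and it preserves inner products because \<open>P\<close> is
  idempotent and self-adjoint.\<close>

lemma exists_reflection:
  assumes vs: "set vs \<subseteq> carrier_vec N"
  shows "\<exists>R. unitary_matrix N R \<and> (\<forall>v \<in> set vs. R *\<^sub>v v = v) \<and>
    (\<forall>x \<in> carrier_vec N. (\<forall>v \<in> set vs. x \<bullet>c v = 0) \<longrightarrow> R *\<^sub>v x = - x)"
proof -
  obtain P where P: "P \<in> carrier_mat N N"
    and idem: "\<And>x. x \<in> carrier_vec N \<Longrightarrow> P *\<^sub>v (P *\<^sub>v x) = P *\<^sub>v x"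
    and sa: "\<And>x y. x \<in> carrier_vec N \<Longrightarrow> y \<in> carrier_vec N \<Longrightarrow> (P *\<^sub>v x) \<bullet>c y = x \<bullet>c (P *\<^sub>v y)"
    and fix_vs: "\<And>u. u \<in> set vs \<Longrightarrow> P *\<^sub>v u = u"
    and kill: "\<And>x. x \<in> carrier_vec N \<Longrightarrow> (\<forall>u \<in> set vs. x \<bullet>c u = 0) \<Longrightarrow> P *\<^sub>v x = 0\<^sub>v N"
    using exists_projection[OF vs] by auto
  define R where "R = 2 \<cdot>\<^sub>m P + (-1) \<cdot>\<^sub>m 1\<^sub>m N"
  have R: "R \<in> carrier_mat N N" using P by (simp add: R_def)
  have Px: "P *\<^sub>v x \<in> carrier_vec N" if "x \<in> carrier_vec N" for x using P that by simp
  have Rx: "R *\<^sub>v x = 2 \<cdot>\<^sub>v (P *\<^sub>v x) + (-1) \<cdot>\<^sub>v x" if x: "x \<in> carrier_vec N" for x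
  proof -
    have "((-1) \<cdot>\<^sub>m 1\<^sub>m N) *\<^sub>v x = (-1) \<cdot>\<^sub>v x" 
      using x by auto
    moreover have "(2 \<cdot>\<^sub>m P) *\<^sub>v x = 2 \<cdot>\<^sub>v (P *\<^sub>v x)"
      using P x by auto
    moreover have "R *\<^sub>v x = (2 \<cdot>\<^sub>m P) *\<^sub>v x + ((-1) \<cdot>\<^sub>m 1\<^sub>m N) *\<^sub>v x"
      unfolding R_def by (rule add_mult_distrib_mat_vec[of _ N N]) (use P x in auto)
    ultimately show ?thesis by simp
  qed
  have "(R *\<^sub>v x) \<bullet>c (R *\<^sub>v y) = x \<bullet>c y" if x: "x \<in> carrier_vec N" and y: "y \<in> carrier_vec N" for x y
  proof -
    have "(R *\<^sub>v x) \<bullet>c (R *\<^sub>v y)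
        = 2 * ((P *\<^sub>v x) \<bullet>c (R *\<^sub>v y)) - x \<bullet>c (R *\<^sub>v y)"
      using cscalar_prod_linear(1)[OF Px[OF x] x, of "R *\<^sub>v y" 2 "-1"] R y by (simp add: Rx[OF x])
    moreover have "(P *\<^sub>v x) \<bullet>c (R *\<^sub>v y) = x \<bullet>c (P *\<^sub>v y)"
      using cscalar_prod_linear(2)[OF Px[OF y] y Px[OF x], of 2 "-1"] sa[OF x y] sa[OF x Px[OF y]] idem[OF y]
      by (simp add: Rx[OF y])
    moreover have "x \<bullet>c (R *\<^sub>v y) = 2 * (x \<bullet>c (P *\<^sub>v y)) - x \<bullet>c y"
      using cscalar_prod_linear(2)[OF Px[OF y] y x, of 2 "-1"] by (simp add: Rx[OF y])
    ultimately show ?thesis by simp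
  qed
  then have "unitary_matrix N R" using R by (simp add: unitary_matrix_iff_isometry)
  moreover have "R *\<^sub>v v = v" if "v \<in> set vs" for v
    using Rx[of v] fix_vs[OF that] vs that R by (intro eq_vecI) auto
  moreover have "R *\<^sub>v x = - x" if x: "x \<in> carrier_vec N" and "\<forall>v \<in> set vs. x \<bullet>c v = 0" for x
    using Rx[OF x] kill[OF that] x by auto
  ultimately show ?thesis by blast
qed

section \<open>Averages of powers of a unitary matrix\<close>

abbreviation mat_iter :: "complex mat \<Rightarrow> nat \<Rightarrow> complex vec \<Rightarrow> complex vec" where
  "mat_iter U t x \<equiv> (((*\<^sub>v) U) ^^ t) x"

lemma mat_iter_carrier:
  assumes "U \<in> carrier_mat N N" "x \<in> carrier_vec N"
  shows "mat_iter U t x \<in> carrier_vec N"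
  using assms by (induction t) auto

lemma mat_iter_smult:
  assumes "U \<in> carrier_mat N N" "x \<in> carrier_vec N"
  shows "mat_iter U t (c \<cdot>\<^sub>v x) = c \<cdot>\<^sub>v mat_iter U t x"
proof (induction t)
  case (Suc t)
  then show ?case
    using mult_mat_vec[OF assms(1) mat_iter_carrier[OF assms]] by simp
qed simp

lemma mat_iter_minus:
  assumes "U \<in> carrier_mat N N" "x \<in> carrier_vec N" "y \<in> carrier_vec N"
  shows "mat_iter U t (x - y) = mat_iter U t x - mat_iter U t y"
proof (induction t)
  case (Suc t)
  then show ?case
    using mult_minus_distrib_mat_vec[OF assms(1) mat_iter_carrier[OF assms(1,2)] mat_iter_carrier[OF assms(1,3)]]
    by simp
qed simp

lemma norm_sq_mat_iter:
  assumes "unitary_matrix N U" "x \<in> carrier_vec N"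
  shows "norm_sq (mat_iter U t x) = norm_sq x"
  using assms by (induction t) (simp_all add: unitary_norm_sq mat_iter_carrier[OF unitary_matrix_carrier])

lemma norm_sq_unit:
  assumes "i < N"
  shows "norm_sq (unit_vec N i) = 1"
proof -
  have "complex_of_real (norm_sq (unit_vec N i)) = unit_vec N i $ i"
    unfolding cscalar_prod_self[symmetric] by (rule cscalar_prod_unit) (use assms in auto)
  then show ?thesis using assms by simp
qed

text \<open>Since \<psi> is fixed, U^t e - e equals U^t (e - \<psi>) - (e - \<psi>), whose squared
  norm is at most four times that of e - \<psi>, uniformly in t. For unit vectors the squared norm
  of U^t e - e is 2 - 2 Re of the amplitude.\<close>

lemma near_fixpoint_amplitude:
  assumes U: "unitary_matrix N U" and N: "0 < N" and \<psi>: "\<psi> \<in> carrier_vec N" and fixp: "U *\<^sub>v \<psi> = \<psi>"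
  shows "Re (mat_iter U t (unit_vec N 0) $ 0) \<ge> 1 - 2 * norm_sq (unit_vec N 0 - \<psi>)"
proof -
  define e :: "complex vec" where "e = unit_vec N 0"
  have e: "e \<in> carrier_vec N" by (simp add: e_def)
  have Uc: "U \<in> carrier_mat N N" by (rule unitary_matrix_carrier[OF U])
  have it\<psi>: "mat_iter U t \<psi> = \<psi>" by (induction t) (simp_all add: fixp)
  have c: "mat_iter U t e \<in> carrier_vec N" by (rule mat_iter_carrier[OF Uc e])
  have "mat_iter U t e - e = mat_iter U t (e - \<psi>) - (e - \<psi>)"
    unfolding mat_iter_minus[OF Uc e \<psi>] it\<psi> using c e \<psi> by auto
  then have "norm_sq (mat_iter U t e - e) \<le> 4 * norm_sq (e - \<psi>)"
    using norm_sq_minus_le[of "mat_iter U t (e - \<psi>)" N "e - \<psi>"] mat_iter_carrier[OF Uc, of "e - \<psi>" t]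
      norm_sq_mat_iter[OF U, of "e - \<psi>" t] e \<psi>
    by simp
  moreover have "norm_sq (mat_iter U t e - e) = norm_sq (mat_iter U t e) - 2 * Re (mat_iter U t e $ 0) + 1"
    using norm_sq_minus_unit[OF c N] by (simp add: e_def)
  moreover have "norm_sq (mat_iter U t e) = 1"
    using norm_sq_mat_iter[OF U e] norm_sq_unit[OF N] by (simp add: e_def)
  ultimately show ?thesis by (simp add: e_def)
qed

text \<open>Applying U^t to the hypothesis gives 2 U^t e = U^t \<eta> - U^(t+1) \<eta>, so the sum
  collapses to two vectors of the length of \<eta>. The bound is free of \<open>T\<close>, and
  division by \<open>T\<close> makes the average small.\<close>

lemma telescoping_amplitude:
  assumes U: "unitary_matrix N U" and N: "0 < N" and \<eta>: "\<eta> \<in> carrier_vec N"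
    and eq: "\<eta> - U *\<^sub>v \<eta> = 2 \<cdot>\<^sub>v unit_vec N 0"
  shows "(cmod (\<Sum>t<T. mat_iter U t (unit_vec N 0) $ 0))\<^sup>2 \<le> norm_sq \<eta>"
proof -
  have Uc: "U \<in> carrier_mat N N" by (rule unitary_matrix_carrier[OF U])
  have c: "mat_iter U t \<eta> \<in> carrier_vec N" for t by (rule mat_iter_carrier[OF Uc \<eta>])
  have step: "2 * mat_iter U t (unit_vec N 0) $ 0 = mat_iter U t \<eta> $ 0 - mat_iter U (Suc t) \<eta> $ 0" for t
  proof -
    have "2 \<cdot>\<^sub>v mat_iter U t (unit_vec N 0) = mat_iter U t (2 \<cdot>\<^sub>v unit_vec N 0)"
      using mat_iter_smult[OF Uc, of "unit_vec N 0"] by simp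
    also have "\<dots> = mat_iter U t \<eta> - mat_iter U t (U *\<^sub>v \<eta>)"
      unfolding eq[symmetric] by (rule mat_iter_minus[OF Uc \<eta>]) (use Uc \<eta> in simp)
    also have "mat_iter U t (U *\<^sub>v \<eta>) = mat_iter U (Suc t) \<eta>"
      by (simp only: funpow_Suc_right o_apply)
    finally have "(2 \<cdot>\<^sub>v mat_iter U t (unit_vec N 0)) $ 0 = (mat_iter U t \<eta> - mat_iter U (Suc t) \<eta>) $ 0"
      by simp
    then show ?thesis
      using c[of "Suc t"] mat_iter_carrier[OF Uc, of "unit_vec N 0" t] N
      by (simp del: funpow.simps index_mult_mat_vec)
  qed
  have sum_eq: "2 * (\<Sum>t<T. mat_iter U t (unit_vec N 0) $ 0) = \<eta> $ 0 - mat_iter U T \<eta> $ 0"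
    unfolding sum_distrib_left step
    by (induction T) (simp_all del: index_mult_mat_vec)
  have "cmod (\<eta> $ 0) \<le> sqrt (norm_sq \<eta>)"
    by (rule real_le_rsqrt, rule cmod_component_le_norm_sq) (use N \<eta> in auto)
  moreover have "cmod (mat_iter U T \<eta> $ 0) \<le> sqrt (norm_sq \<eta>)"
    unfolding norm_sq_mat_iter[OF U \<eta>, of T, symmetric]
    by (rule real_le_rsqrt, rule cmod_component_le_norm_sq) (use N c[of T] in auto)
  ultimately have "cmod (2 * (\<Sum>t<T. mat_iter U t (unit_vec N 0) $ 0)) \<le> 2 * sqrt (norm_sq \<eta>)"
    using norm_triangle_ineq4[of "\<eta> $ 0" "mat_iter U T \<eta> $ 0"] unfolding sum_eq by linarith
  then have "cmod (\<Sum>t<T. mat_iter U t (unit_vec N 0) $ 0) \<le> sqrt (norm_sq \<eta>)"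
    by (simp only: norm_mult norm_numeral)
  from power_mono[OF this norm_ge_zero, of 2] show ?thesis
    using norm_sq_nonneg[of \<eta>] by simp
qed

section \<open>Block-diagonal matrices\<close>

definition block_vec :: "nat \<Rightarrow> nat \<Rightarrow> (nat \<Rightarrow> complex vec) \<Rightarrow> complex vec" where
  "block_vec N T \<psi> = vec (N * T) (\<lambda>a. \<psi> (a mod T) $ (a div T))"

definition block_mat :: "nat \<Rightarrow> nat \<Rightarrow> (nat \<Rightarrow> complex mat) \<Rightarrow> complex mat" where
  "block_mat N T M = mat (N * T) (N * T)
     (\<lambda>(a, b). if a mod T = b mod T then M (a mod T) $$ (a div T, b div T) else 0)"

lemma block_carrier [simp]:
  "block_vec N T \<psi> \<in> carrier_vec (N * T)" "block_mat N T M \<in> carrier_mat (N * T) (N * T)"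
  by (simp_all add: block_vec_def block_mat_def)

lemma sum_div_mod:
  fixes f :: "nat \<Rightarrow> 'a :: comm_monoid_add"
  shows "(\<Sum>a<N * T. f a) = (\<Sum>t<T. \<Sum>i<N. f (i * T + t))"
proof -
  have "(\<Sum>a<N * T. f a) = (\<Sum>i<N. \<Sum>a\<in>{i * T..<i * T + T}. f a)"
    by (simp add: sum.nat_group)
  also have "\<dots> = (\<Sum>i<N. \<Sum>t<T. f (i * T + t))"
  proof (rule sum.cong)
    fix i
    show "(\<Sum>a\<in>{i * T..<i * T + T}. f a) = (\<Sum>t<T. f (i * T + t))"
      using sum.shift_bounds_nat_ivl[of f 0 "i * T" T] by (simp add: lessThan_atLeast0 add.commute)
  qed simp
  finally show ?thesis by (simp add: sum.swap[of _ "{..<N}"])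
qed

lemma block_index_less:
  assumes "i < N" "t < T"
  shows "i * T + t < N * (T::nat)"
proof -
  have "i * T + t < Suc i * T" using assms by simp
  also have "\<dots> \<le> N * T" using assms by (intro mult_right_mono) auto
  finally show ?thesis .
qed

lemma sum_mod_div:
  fixes g :: "nat \<Rightarrow> nat \<Rightarrow> 'a :: comm_monoid_add"
  shows "(\<Sum>a<N * T. g (a mod T) (a div T)) = (\<Sum>t<T. \<Sum>i<N. g t i)"
  unfolding sum_div_mod by (intro sum.cong refl) simp

lemma cscalar_prod_block:
  assumes "\<And>t. t < T \<Longrightarrow> \<phi> t \<in> carrier_vec N"
  shows "block_vec N T \<psi> \<bullet>c block_vec N T \<phi> = (\<Sum>t<T. \<psi> t \<bullet>c \<phi> t)"
proof -
  have "block_vec N T \<psi> \<bullet>c block_vec N T \<phi> = (\<Sum>t<T. \<Sum>i<N. \<psi> t $ i * cnj (\<phi> t $ i))"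
    by (subst cscalar_prod_sum[of _ "N * T"]) (auto simp: sum_div_mod block_vec_def block_index_less intro!: sum.cong)
  then show ?thesis
    using assms by (simp add: cscalar_prod_sum[of _ N])
qed

lemma block_mult_vec:
  assumes M: "\<And>t. t < T \<Longrightarrow> M t \<in> carrier_mat N N" and \<psi>: "\<And>t. t < T \<Longrightarrow> \<psi> t \<in> carrier_vec N"
  shows "block_mat N T M *\<^sub>v block_vec N T \<psi> = block_vec N T (\<lambda>t. M t *\<^sub>v \<psi> t)"
proof (rule eq_vecI)
  fix a assume "a < dim_vec (block_vec N T (\<lambda>t. M t *\<^sub>v \<psi> t))"
  then have a: "a < N * T" by (simp add: block_vec_def)
  then have T: "T > 0" using gr0I by fastforce
  have ad: "a div T < N" using a by (simp add: less_mult_imp_div_less)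
  have am: "a mod T < T" using T by simp
  have "(block_mat N T M *\<^sub>v block_vec N T \<psi>) $ a
      = (\<Sum>b<N * T. block_mat N T M $$ (a, b) * block_vec N T \<psi> $ b)"
    using a by (simp add: block_mat_def block_vec_def scalar_prod_def lessThan_atLeast0)
  also have "\<dots> = (\<Sum>t<T. \<Sum>i<N. (if a mod T = t then M t $$ (a div T, i) * \<psi> t $ i else 0))"
    unfolding sum_div_mod using a by (auto simp: block_mat_def block_vec_def block_index_less intro!: sum.cong)
  also have "\<dots> = (\<Sum>t<T. if a mod T = t then \<Sum>i<N. M t $$ (a div T, i) * \<psi> t $ i else 0)"
    by (rule sum.cong) auto
  also have "\<dots> = (\<Sum>i<N. M (a mod T) $$ (a div T, i) * \<psi> (a mod T) $ i)"
    using am by simp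
  also have "\<dots> = block_vec N T (\<lambda>t. M t *\<^sub>v \<psi> t) $ a"
    using a ad M[OF am] \<psi>[OF am] by (simp add: block_vec_def scalar_prod_def lessThan_atLeast0)
  finally show "(block_mat N T M *\<^sub>v block_vec N T \<psi>) $ a = block_vec N T (\<lambda>t. M t *\<^sub>v \<psi> t) $ a" .
qed (simp add: block_mat_def block_vec_def)

lemma block_vec_cong:
  assumes "\<And>t. t < T \<Longrightarrow> \<psi> t = \<phi> t"
  shows "block_vec N T \<psi> = block_vec N T \<phi>"
proof (rule eq_vecI)
  fix a assume "a < dim_vec (block_vec N T \<phi>)"
  then have a: "a < N * T" by (simp add: block_vec_def)
  then have "T > 0" using gr0I by fastforce
  then show "block_vec N T \<psi> $ a = block_vec N T \<phi> $ a"
    using a assms by (simp add: block_vec_def)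
qed (simp add: block_vec_def)

lemma block_vec_surj:
  assumes v: "v \<in> carrier_vec (N * T)"
  shows "\<exists>\<psi>. (\<forall>t. \<psi> t \<in> carrier_vec N) \<and> v = block_vec N T \<psi>"
proof (intro exI conjI allI)
  let ?\<psi> = "\<lambda>t. vec N (\<lambda>i. v $ (i * T + t))"
  show "?\<psi> t \<in> carrier_vec N" for t by simp
  show "v = block_vec N T ?\<psi>"
    by (rule eq_vecI) (use v in \<open>auto simp: block_vec_def less_mult_imp_div_less\<close>)
qed

lemma unitary_block_mat:
  assumes U: "\<And>t. t < T \<Longrightarrow> unitary_matrix N (M t)"
  shows "unitary_matrix (N * T) (block_mat N T M)"
proof (subst unitary_matrix_iff_isometry, simp, intro ballI)
  have M: "M t \<in> carrier_mat N N" if "t < T" for t by (rule unitary_matrix_carrier[OF U[OF that]])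
  fix x y :: "complex vec"
  assume "x \<in> carrier_vec (N * T)" "y \<in> carrier_vec (N * T)"
  then obtain \<psi> \<phi> where c: "\<And>t. \<psi> t \<in> carrier_vec N" "\<And>t. \<phi> t \<in> carrier_vec N"
    and xy: "x = block_vec N T \<psi>" "y = block_vec N T \<phi>"
    using block_vec_surj[of x] block_vec_surj[of y] by metis
  have Mc: "M t *\<^sub>v \<phi> t \<in> carrier_vec N" if "t < T" for t
    using M[OF that] c(2) by (rule mult_mat_vec_carrier)
  show "(block_mat N T M *\<^sub>v x) \<bullet>c (block_mat N T M *\<^sub>v y) = x \<bullet>c y"
  proof -
    have "(block_mat N T M *\<^sub>v x) \<bullet>c (block_mat N T M *\<^sub>v y)
        = (\<Sum>t<T. (M t *\<^sub>v \<psi> t) \<bullet>c (M t *\<^sub>v \<phi> t))"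
      using M Mc c by (simp add: xy block_mult_vec cscalar_prod_block)
    also have "\<dots> = (\<Sum>t<T. \<psi> t \<bullet>c \<phi> t)"
      by (rule sum.cong) (use unitary_cscalar_prod[OF U c(1) c(2)] in auto)
    also have "\<dots> = x \<bullet>c y"
      using c by (simp add: xy cscalar_prod_block)
    finally show ?thesis .
  qed
qed

text \<open>The sign depends only on the register, and \<open>a div (K * T) = a div T div K\<close>
  reads the same register in either indexing. Hence one query serves all branches at once.\<close>

lemma phase_oracle_block:
  assumes \<psi>: "\<And>t. t < T \<Longrightarrow> \<psi> t \<in> carrier_vec (2 ^ n * K)"
  shows "phase_oracle n (K * T) f *\<^sub>v block_vec (2 ^ n * K) T \<psi>
    = block_vec (2 ^ n * K) T (\<lambda>t. phase_oracle n K f *\<^sub>v \<psi> t)"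
proof (rule eq_vecI)
  fix a assume "a < dim_vec (block_vec (2 ^ n * K) T (\<lambda>t. phase_oracle n K f *\<^sub>v \<psi> t))"
  then have a: "a < 2 ^ n * K * T" by (simp add: block_vec_def)
  then have T: "T > 0" using gr0I by fastforce
  have ad: "a div T < 2 ^ n * K" using a by (simp add: less_mult_imp_div_less)
  have c: "\<psi> (a mod T) \<in> carrier_vec (2 ^ n * K)" using \<psi> T by simp
  have d: "a div (K * T) = a div T div K" by (simp add: div_mult2_eq mult.commute[of K])
  show "(phase_oracle n (K * T) f *\<^sub>v block_vec (2 ^ n * K) T \<psi>) $ a
      = block_vec (2 ^ n * K) T (\<lambda>t. phase_oracle n K f *\<^sub>v \<psi> t) $ a"
    using a ad diag_matrix_mult_vec[OF c]
      diag_matrix_mult_vec[OF block_carrier(1), of "2 ^ n * K" T _ \<psi>]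
    by (simp add: phase_oracle_diag block_vec_def d mult.assoc del: index_mult_mat_vec)
qed (simp add: block_vec_def phase_oracle_def)

section \<open>The averaging algorithm\<close>

lemma register_set_0 [simp]: "register_set 0 = {}"
  by (simp add: register_set_def)

lemma foldl_unitary_norm_sq:
  assumes "\<forall>U \<in> set Us. unitary_matrix (2 ^ n * m) U" "\<psi> \<in> carrier_vec (2 ^ n * m)"
  shows "foldl (\<lambda>\<psi> U. U *\<^sub>v (phase_oracle n m f *\<^sub>v \<psi>)) \<psi> Us \<in> carrier_vec (2 ^ n * m) \<and>
    norm_sq (foldl (\<lambda>\<psi> U. U *\<^sub>v (phase_oracle n m f *\<^sub>v \<psi>)) \<psi> Us) = norm_sq \<psi>"
  using assms
proof (induction Us arbitrary: \<psi>)
  case (Cons U Us)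
  have U: "unitary_matrix (2 ^ n * m) U" using Cons.prems by simp
  have O: "phase_oracle n m f *\<^sub>v \<psi> \<in> carrier_vec (2 ^ n * m)"
    using unitary_matrix_carrier[OF unitary_phase_oracle] Cons.prems(2) by (rule mult_mat_vec_carrier)
  have "U *\<^sub>v (phase_oracle n m f *\<^sub>v \<psi>) \<in> carrier_vec (2 ^ n * m)"
    using unitary_matrix_carrier[OF U] O by (rule mult_mat_vec_carrier)
  moreover have "norm_sq (U *\<^sub>v (phase_oracle n m f *\<^sub>v \<psi>)) = norm_sq \<psi>"
    using unitary_norm_sq[OF U O] unitary_norm_sq[OF unitary_phase_oracle Cons.prems(2)] by simp
  ultimately show ?case
    using Cons.IH[of "U *\<^sub>v (phase_oracle n m f *\<^sub>v \<psi>)"] Cons.prems by simp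
qed simp

text \<open>Unitaries and queries preserve the norm, so the two probabilities sum to 1 and a single
  amplitude decides both.\<close>

lemma answer_prob_index_0:
  assumes Q: "quantum_query_algorithm n Q" and ans: "answer Q = (\<lambda>j. j \<noteq> 0)"
  shows "answer_prob n Q f False = (cmod (final_state n Q f $ 0))\<^sup>2"
    and "answer_prob n Q f True = 1 - (cmod (final_state n Q f $ 0))\<^sup>2"
proof -
  have pos: "0 < state_dim n Q"
    using Q by (simp add: quantum_query_algorithm_def state_dim_def)
  have I: "unitary_matrix (state_dim n Q) (initial_unitary Q)"
    using Q by (simp add: quantum_query_algorithm_def)
  have c: "initial_unitary Q *\<^sub>v unit_vec (state_dim n Q) 0 \<in> carrier_vec (state_dim n Q)"
    using unitary_matrix_carrier[OF I] by (rule mult_mat_vec_carrier) simp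
  have fin: "final_state n Q f \<in> carrier_vec (state_dim n Q)" "norm_sq (final_state n Q f) = 1"
    using foldl_unitary_norm_sq[of "later_unitaries Q" n "workspace_dim Q" _ f] c Q
      unitary_norm_sq[OF I, of "unit_vec (state_dim n Q) 0"] norm_sq_unit[OF pos]
    by (auto simp: final_state_def state_dim_def quantum_query_algorithm_def)
  show F: "answer_prob n Q f False = (cmod (final_state n Q f $ 0))\<^sup>2"
  proof -
    have "{j. j < state_dim n Q \<and> answer Q j = False} = {0}"
      using pos ans by auto
    then show ?thesis by (simp only: answer_prob_def) simp
  qed
  have "{j. j < state_dim n Q \<and> answer Q j = True} = {..<state_dim n Q} - {0}"
    using ans by auto
  then have "answer_prob n Q f True = norm_sq (final_state n Q f) - (cmod (final_state n Q f $ 0))\<^sup>2"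
    using pos fin(1) by (simp only: answer_prob_def) (simp add: norm_sq_def sum_diff1)
  then show "answer_prob n Q f True = 1 - (cmod (final_state n Q f $ 0))\<^sup>2"
    using fin(2) by simp
qed

text \<open>The reflection about the midpoint of \<open>x\<close> and \<open>y\<close>. Equal norms
  and a symmetric inner product say exactly that half the difference is orthogonal to the midpoint,
  so its sign is flipped. It serves to prepare and to undo the superposition of branches without
  queries.\<close>

lemma exists_exchanging_unitary:
  fixes x y :: "complex vec"
  assumes x: "x \<in> carrier_vec N" and y: "y \<in> carrier_vec N"
    and norm: "norm_sq x = norm_sq y" and sym: "x \<bullet>c y = y \<bullet>c x"
  shows "\<exists>H. unitary_matrix N H \<and> H *\<^sub>v x = y \<and> H *\<^sub>v y = x"
proof -
  define s where "s = (1 / 2) \<cdot>\<^sub>v x + (1 / 2) \<cdot>\<^sub>v y"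
  define d where "d = (1 / 2) \<cdot>\<^sub>v x + (- 1 / 2) \<cdot>\<^sub>v y"
  have s: "s \<in> carrier_vec N" and d: "d \<in> carrier_vec N" using x y by (auto simp: s_def d_def)
  have ds: "d \<bullet>c s = 0"
    using cscalar_prod_linear(1)[OF x y s, of "1 / 2" "- 1 / 2"]
      cscalar_prod_linear(2)[OF x y x, of "1 / 2" "1 / 2"]
      cscalar_prod_linear(2)[OF x y y, of "1 / 2" "1 / 2"] sym norm
    by (simp add: d_def s_def cscalar_prod_self)
  obtain H where H: "unitary_matrix N H" "H *\<^sub>v s = s"
    and anti: "\<forall>z \<in> carrier_vec N. (\<forall>v \<in> set [s]. z \<bullet>c v = 0) \<longrightarrow> H *\<^sub>v z = - z"
    using exists_reflection[of "[s]" N] s by auto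
  have Hd: "H *\<^sub>v d = - d" using anti d ds by simp
  have Hc: "H \<in> carrier_mat N N" by (rule unitary_matrix_carrier[OF H(1)])
  have xsd: "x = s + d" and ysd: "y = s - d" using x y by (auto simp: s_def d_def field_simps)
  have "H *\<^sub>v x = y"
    unfolding xsd mult_add_distrib_mat_vec[OF Hc s d] H(2) Hd ysd using s d by auto
  moreover have "H *\<^sub>v y = x"
    unfolding ysd mult_minus_distrib_mat_vec[OF Hc s d] H(2) Hd xsd using s d by auto
  ultimately show ?thesis using H(1) by blast
qed

text \<open>
  Branch t of the workspace has to apply M exactly t times although all branches share their queries.
  It therefore idles during the first T - t queries, which do not disturb its state |{}>, and only then
  starts to apply M.
\<close>

lemma averaging_algorithm:
  assumes M: "unitary_matrix (2 ^ n * K) M" and K: "K > 0" and T: "T > 0"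
  shows "\<exists>Q. quantum_query_algorithm n Q \<and> num_queries Q = T + 1 \<and>
    (\<forall>f z. f {} = 0 \<longrightarrow>
       z = (\<Sum>t<T. mat_iter (M * phase_oracle n K f) t (unit_vec (2 ^ n * K) 0) $ 0) / of_nat T \<longrightarrow>
       answer_prob n Q f False = (cmod z)\<^sup>2 \<and> answer_prob n Q f True = 1 - (cmod z)\<^sup>2)"
proof -
  define N where "N = 2 ^ n * K"
  have N: "N > 0" using K by (simp add: N_def)
  have NT: "2 ^ n * (K * T) = N * T" by (simp add: N_def)
  define e :: "complex vec" where "e = unit_vec N 0"
  have e: "e \<in> carrier_vec N" by (simp add: e_def)
  define c :: complex where "c = of_real (1 / sqrt (real T))"
  have cc: "c * c = 1 / of_nat T" "cnj c = c"
  proof -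
    have "c * c = of_real (1 / sqrt (real T) * (1 / sqrt (real T)))"
      unfolding c_def of_real_mult ..
    also have "1 / sqrt (real T) * (1 / sqrt (real T)) = 1 / real T"
      using T by simp
    finally show "c * c = 1 / of_nat T" by simp
    show "cnj c = c" by (simp add: c_def)
  qed
  \<comment> \<open>The uniform superposition of the branches, each holding the start vector;
    \<open>c\<close> normalises it.\<close>
  define \<Omega> where "\<Omega> = block_vec N T (\<lambda>t. c \<cdot>\<^sub>v e)"
  have \<Omega>: "\<Omega> \<in> carrier_vec (N * T)" by (simp add: \<Omega>_def)
  define E :: "complex vec" where "E = unit_vec (N * T) 0"
  have E: "E \<in> carrier_vec (N * T)" by (simp add: E_def)
  have ee: "e \<bullet>c e = 1" using N by (simp add: cscalar_prod_self e_def norm_sq_unit)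
  have inner_\<Omega>: "block_vec N T \<psi> \<bullet>c \<Omega> = c * (\<Sum>t<T. \<psi> t $ 0)"
    if \<psi>: "\<And>t. t < T \<Longrightarrow> \<psi> t \<in> carrier_vec N" for \<psi>
  proof -
    have *: "c \<cdot>\<^sub>v e + 0 \<cdot>\<^sub>v e = c \<cdot>\<^sub>v e"
      using e by (intro eq_vecI) auto
    have "\<psi> t \<bullet>c (c \<cdot>\<^sub>v e) = c * \<psi> t $ 0" if "t < T" for t
      using cscalar_prod_linear(2)[OF e e \<psi>[OF that], of c 0, unfolded *] cscalar_prod_unit[OF \<psi>[OF that] N]
      by (simp add: e_def cc(2))
    then show ?thesis
      unfolding \<Omega>_def using e by (subst cscalar_prod_block) (auto simp: sum_distrib_left)
  qed
  have "\<Omega> \<bullet>c \<Omega> = 1"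
  proof -
    have "\<Omega> \<bullet>c \<Omega> = c * (\<Sum>t<T. (c \<cdot>\<^sub>v e) $ 0)"
      using inner_\<Omega>[of "\<lambda>t. c \<cdot>\<^sub>v e"] e by (simp add: \<Omega>_def[symmetric])
    also have "\<dots> = of_nat T * (c * c)"
      using N by (simp add: e_def)
    finally show ?thesis using T by (simp add: cc(1))
  qed
  then have norm_\<Omega>: "norm_sq \<Omega> = 1"
    by (metis cscalar_prod_self of_real_eq_1_iff)
  have "\<Omega> \<bullet>c E = c"
    unfolding E_def using \<Omega> N T by (subst cscalar_prod_unit[of _ "N * T"]) (auto simp: \<Omega>_def block_vec_def e_def)
  moreover from this have "E \<bullet>c \<Omega> = c"
    using cnj_cscalar_prod[OF \<Omega> E] cc(2) by simp
  ultimately obtain H where H: "unitary_matrix (N * T) H" "H *\<^sub>v E = \<Omega>" "H *\<^sub>v \<Omega> = E"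
    using exists_exchanging_unitary[OF E \<Omega>] norm_\<Omega> norm_sq_unit[of 0 "N * T"] N T by (auto simp: E_def)
  \<comment> \<open>In the rounds j = 0, ..., T - 1 the condition \<open>t + j \<ge> T\<close> holds
    exactly in the last t, so branch t applies \<open>M\<close> t times.\<close>
  define B where "B j = (\<lambda>t. if t + j \<ge> T then M else 1\<^sub>m N)" for j
  have B: "unitary_matrix N (B j t)" for j t
    using M by (simp add: B_def N_def unitary_matrix_one)
  define V where "V j = block_mat N T (B j)" for j
  have V: "unitary_matrix (N * T) (V j)" for j
    unfolding V_def by (rule unitary_block_mat) (rule B)
  \<comment> \<open>Every later unitary comes after a query, so the closing \<open>H\<close> costs
    one query beyond the \<open>T\<close> rounds.\<close>
  define Q where "Q = \<lparr>workspace_dim = K * T, initial_unitary = H,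
    later_unitaries = map V [0..<T] @ [H], answer = (\<lambda>j. j \<noteq> 0)\<rparr>"
  have dimQ: "state_dim n Q = N * T" by (simp add: state_dim_def Q_def N_def)
  have Q: "quantum_query_algorithm n Q"
    unfolding quantum_query_algorithm_def dimQ using K T H(1) V by (auto simp: Q_def)
  have final: "final_state n Q f $ 0 = (\<Sum>t<T. mat_iter (M * phase_oracle n K f) t e $ 0) / of_nat T"
    if f: "f {} = 0" for f
  proof -
    define O' where "O' = phase_oracle n K f"
    have O': "unitary_matrix N O'" unfolding O'_def N_def by (rule unitary_phase_oracle)
    have Oe: "O' *\<^sub>v e = e"
      unfolding O'_def phase_oracle_diag N_def[symmetric] diag_matrix_mult_vec[OF e]
      by (rule eq_vecI) (auto simp: e_def f)
    define W where "W = M * O'"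
    have Wc: "W \<in> carrier_mat N N"
      unfolding W_def using unitary_matrix_carrier[OF M[folded N_def]] unitary_matrix_carrier[OF O']
      by (rule mult_carrier_mat)
    \<comment> \<open>The state of branch t after j rounds. Truncated subtraction keeps the exponent
      at 0 while the branch idles.\<close>
    define \<psi> where "\<psi> j t = c \<cdot>\<^sub>v mat_iter W (t + j - T) e" for j t
    have \<psi>: "\<psi> j t \<in> carrier_vec N" for j t
      unfolding \<psi>_def using mat_iter_carrier[OF Wc e] by simp
    define F where "F = foldl (\<lambda>\<psi> U. U *\<^sub>v (phase_oracle n (K * T) f *\<^sub>v \<psi>))"
    have phase_block: "phase_oracle n (K * T) f *\<^sub>v block_vec N T \<phi> = block_vec N T (\<lambda>t. O' *\<^sub>v \<phi> t)"
      if "\<And>t. \<phi> t \<in> carrier_vec N" for \<phi>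
      using phase_oracle_block[of T \<phi> n K f] that by (simp add: N_def O'_def)
    have O'c: "O' *\<^sub>v x \<in> carrier_vec N" if "x \<in> carrier_vec N" for x
      using unitary_matrix_carrier[OF O'] that by (rule mult_mat_vec_carrier)
    have step: "V j *\<^sub>v (phase_oracle n (K * T) f *\<^sub>v block_vec N T (\<psi> j)) = block_vec N T (\<psi> (Suc j))" for j
    proof -
      have "V j *\<^sub>v (phase_oracle n (K * T) f *\<^sub>v block_vec N T (\<psi> j))
          = block_vec N T (\<lambda>t. B j t *\<^sub>v (O' *\<^sub>v \<psi> j t))"
        unfolding phase_block[OF \<psi>] V_def
        by (rule block_mult_vec) (use unitary_matrix_carrier[OF B] O'c[OF \<psi>] in auto)
      also have "\<dots> = block_vec N T (\<psi> (Suc j))"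
      proof (rule block_vec_cong)
        fix t
        let ?x = "mat_iter W (t + j - T) e"
        have x: "?x \<in> carrier_vec N" by (rule mat_iter_carrier[OF Wc e])
        have sm: "O' *\<^sub>v \<psi> j t = c \<cdot>\<^sub>v (O' *\<^sub>v ?x)"
          unfolding \<psi>_def by (rule mult_mat_vec[OF unitary_matrix_carrier[OF O'] x])
        show "B j t *\<^sub>v (O' *\<^sub>v \<psi> j t) = \<psi> (Suc j) t"
        proof (cases "t + j \<ge> T")
          case True
          have Mc: "M \<in> carrier_mat N N" using unitary_matrix_carrier[OF M] by (simp add: N_def)
          have "B j t *\<^sub>v (O' *\<^sub>v \<psi> j t) = c \<cdot>\<^sub>v (M *\<^sub>v (O' *\<^sub>v ?x))"
            unfolding sm using True mult_mat_vec[OF Mc O'c[OF x]] by (simp add: B_def)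
          also have "M *\<^sub>v (O' *\<^sub>v ?x) = W *\<^sub>v ?x"
            using assoc_mult_mat_vec[OF Mc unitary_matrix_carrier[OF O'] x] unfolding W_def by (rule sym)
          finally show ?thesis using True by (simp add: \<psi>_def Suc_diff_le)
        next
          case False
          then show ?thesis
            using sm e Oe by (simp add: B_def \<psi>_def)
        qed
      qed
      finally show ?thesis .
    qed
    have "F \<Omega> (map V [0..<j]) = block_vec N T (\<psi> j)" if "j \<le> T" for j
      using that
    proof (induction j)
      case 0
      then show ?case
        unfolding F_def \<Omega>_def by (auto simp: \<psi>_def intro!: block_vec_cong)
    next
      case (Suc j)
      then show ?case using step[of j] by (simp add: F_def)
    qed
    then have F: "F \<Omega> (map V [0..<T]) = block_vec N T (\<psi> T)" by simp
    \<comment> \<open>The query before the closing \<open>H\<close> fixes \<Omega>, so it drops out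
      of the inner product with \<Omega>.\<close>
    have \<Omega>O: "\<Omega> = phase_oracle n (K * T) f *\<^sub>v \<Omega>"
      unfolding \<Omega>_def using e Oe mult_mat_vec[OF unitary_matrix_carrier[OF O'] e]
      by (subst phase_block) (auto intro!: block_vec_cong)
    define \<Phi> where "\<Phi> = phase_oracle n (K * T) f *\<^sub>v block_vec N T (\<psi> T)"
    have Ou: "unitary_matrix (N * T) (phase_oracle n (K * T) f)"
      using unitary_phase_oracle[of n "K * T" f] by (simp add: NT)
    have \<Phi>: "\<Phi> \<in> carrier_vec (N * T)"
      unfolding \<Phi>_def using unitary_matrix_carrier[OF Ou] by (rule mult_mat_vec_carrier) simp
    have "final_state n Q f = H *\<^sub>v \<Phi>"
      unfolding final_state_def dimQ E_def[symmetric]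
      using H(2) F by (simp add: Q_def F_def \<Phi>_def)
    \<comment> \<open>Since \<open>H\<close> maps \<Omega> to \<open>E\<close>, the amplitude at
      index 0 is the overlap with \<Omega>. One factor \<open>c\<close> comes from \<Omega> and one
      from the state, and together they give the 1 / T of the average.\<close>
    then have "final_state n Q f $ 0 = (H *\<^sub>v \<Phi>) \<bullet>c E"
      unfolding E_def using H(1) \<Phi> N T
      by (subst cscalar_prod_unit[of _ "N * T"]) (auto dest: unitary_matrix_carrier)
    also have "\<dots> = \<Phi> \<bullet>c \<Omega>"
      unfolding H(3)[symmetric] by (rule unitary_cscalar_prod[OF H(1) \<Phi> \<Omega>])
    also have "\<dots> = block_vec N T (\<psi> T) \<bullet>c \<Omega>"
      by (subst \<Omega>O) (simp only: \<Phi>_def unitary_cscalar_prod[OF Ou block_carrier(1) \<Omega>])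
    also have "\<dots> = c * (\<Sum>t<T. \<psi> T t $ 0)"
      by (rule inner_\<Omega>[OF \<psi>])
    also have "(\<Sum>t<T. \<psi> T t $ 0) = c * (\<Sum>t<T. mat_iter W t e $ 0)"
      unfolding sum_distrib_left
      by (rule sum.cong) (use mat_iter_carrier[OF Wc e, THEN carrier_vecD] N in \<open>auto simp: \<psi>_def\<close>)
    finally show ?thesis
      using cc(1) by (simp add: W_def O'_def mult.assoc[symmetric])
  qed
  show ?thesis
    using Q final answer_prob_index_0[OF Q] by (intro exI[of _ Q]) (auto simp: Q_def num_queries_def e_def N_def)
qed

section \<open>Random sets and amplitudes\<close>

definition bernoulli_weight :: "nat \<Rightarrow> real \<Rightarrow> nat set \<Rightarrow> real" where
  "bernoulli_weight n p S = p ^ card S * (1 - p) ^ (n - card S)"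

lemma bernoulli_weight_nonneg:
  "0 \<le> p \<Longrightarrow> p \<le> 1 \<Longrightarrow> bernoulli_weight n p S \<ge> 0"
  by (simp add: bernoulli_weight_def)

text \<open>The expectation of y ^ |B \<inter> S| on the event that S misses A. Elements enter S
  independently, so it factorises: an element of A contributes 1 - p, one of B - A contributes 1 - p
  + p y, and any other contributes 1.\<close>

lemma sum_bernoulli_weight:
  assumes A: "A \<subseteq> {1..n}" and B: "B \<subseteq> {1..n}"
  shows "(\<Sum>S\<in>Pow {1..n}. if A \<inter> S = {} then bernoulli_weight n p S * y ^ card (B \<inter> S) else 0)
    = (1 - p) ^ card A * (1 - p + p * y) ^ card (B - A)"
proof -
  \<comment> \<open>The factor of i when it belongs to S. The value 0 on A removes the sets S that
    meet A, so that expanding the product of \<open>f i + (1 - p)\<close> yields the sum.\<close>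
  define f where "f i = (if i \<in> A then 0 else if i \<in> B then p * y else p)" for i
  have "(\<Sum>S\<in>Pow {1..n}. if A \<inter> S = {} then bernoulli_weight n p S * y ^ card (B \<inter> S) else 0)
      = (\<Sum>S\<in>Pow {1..n}. prod f S * (\<Prod>i\<in>{1..n} - S. 1 - p))"
  proof (rule sum.cong)
    fix S assume "S \<in> Pow {1..n}"
    then have S: "S \<subseteq> {1..n}" "finite S" by (auto intro: finite_subset)
    have "prod f S = p ^ card S * y ^ card (B \<inter> S)" if disj: "A \<inter> S = {}"
    proof -
      have "prod f S = (\<Prod>i\<in>S. p * (if i \<in> B then y else 1))"
        by (rule prod.cong) (use disj in \<open>auto simp: f_def\<close>)
      also have "\<dots> = p ^ card S * y ^ card (B \<inter> S)"
        using S by (simp add: prod.distrib prod.If_cases Int_commute)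
      finally show ?thesis .
    qed
    moreover have "prod f S = 0" if "A \<inter> S \<noteq> {}"
    proof -
      from that obtain i where "i \<in> S" "i \<in> A" by blast
      then show ?thesis using S by (intro prod_zero) (auto simp: f_def)
    qed
    moreover have "card ({1..n} - S) = n - card S"
      using S by (simp add: card_Diff_subset)
    ultimately show "(if A \<inter> S = {} then bernoulli_weight n p S * y ^ card (B \<inter> S) else 0)
        = prod f S * (\<Prod>i\<in>{1..n} - S. 1 - p)"
      by (simp add: bernoulli_weight_def)
  qed simp
  also have "\<dots> = (\<Prod>i\<in>{1..n}. f i + (1 - p))"
    by (simp add: prod_add)
  also have "\<dots> = (\<Prod>i\<in>{1..n}. (if i \<in> A then 1 - p else 1) * (if i \<in> B - A then 1 - p + p * y else 1))"
    by (rule prod.cong) (auto simp: f_def)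
  also have "\<dots> = (1 - p) ^ card ({1..n} \<inter> A) * (1 - p + p * y) ^ card ({1..n} \<inter> (B - A))"
    by (simp add: prod.distrib prod.If_cases Collect_mem_eq del: Diff_iff)
  also have "{1..n} \<inter> A = A" using A by blast
  also have "{1..n} \<inter> (B - A) = B - A" using B by blast
  finally show ?thesis .
qed

lemma sum_bernoulli_weight_all:
  assumes B: "B \<subseteq> {1..n}"
  shows "(\<Sum>S\<in>Pow {1..n}. bernoulli_weight n p S * y ^ card (B \<inter> S)) = (1 - p + p * y) ^ card B"
  using sum_bernoulli_weight[of "{}" n B p y] B by simp

text \<open>As \<open>0 ^ 0 = 1\<close>, the difference is the power of x with the case j = 0
  replaced by 0, and this cut-off commutes with squaring.\<close>

lemma power_minus_zero_power_squared:
  fixes x :: real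
  shows "(x ^ j - 0 ^ j)\<^sup>2 = (x\<^sup>2) ^ j - 0 ^ j"
  by (cases "j = 0") (simp_all add: power_0_left power_mult[symmetric] mult.commute)

section \<open>The layered state space and the signed query\<close>

text \<open>
  The workspace index c = 0 carries the start vector; c = i and c = L + i, for i in {1..L}, carry the
  two directions of level i, \<open>F i\<close> and \<open>G i\<close>. On the second one the sign of the query is reversed
  (\<open>layer_sign\<close>), since there the roles of the sizes k and k + d are exchanged.
\<close>

definition layered_vec :: "nat \<Rightarrow> nat \<Rightarrow> real \<Rightarrow> (nat \<Rightarrow> nat set \<Rightarrow> real) \<Rightarrow> (nat \<Rightarrow> nat set \<Rightarrow> real) \<Rightarrow> complex vec"
  where "layered_vec n L u F G = vec (2 ^ n * (2 * L + 1)) (\<lambda>j.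
    let S = register_set (j div (2 * L + 1)); c = j mod (2 * L + 1)
    in of_real (if c = 0 then if S = {} then u else 0 else if c \<le> L then F c S else G (c - L) S))"

lemma layered_vec_carrier [simp]: "layered_vec n L u F G \<in> carrier_vec (2 ^ n * (2 * L + 1))"
  by (simp add: layered_vec_def)

lemma sum_layers:
  fixes h :: "nat \<Rightarrow> nat set \<Rightarrow> 'a :: comm_monoid_add"
  shows "(\<Sum>j<2 ^ n * (2 * L + 1). h (j mod (2 * L + 1)) (register_set (j div (2 * L + 1))))
    = (\<Sum>S\<in>Pow {1..n}. h 0 S) + (\<Sum>i=1..L. \<Sum>S\<in>Pow {1..n}. h i S)
      + (\<Sum>i=1..L. \<Sum>S\<in>Pow {1..n}. h (i + L) S)"
proof -
  have "(\<Sum>j<2 ^ n * (2 * L + 1). h (j mod (2 * L + 1)) (register_set (j div (2 * L + 1))))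
      = (\<Sum>c<2 * L + 1. \<Sum>s<2 ^ n. h c (register_set s))"
    by (rule sum_mod_div)
  also have "\<dots> = (\<Sum>c<2 * L + 1. \<Sum>S\<in>Pow {1..n}. h c S)"
    by (intro sum.cong refl sum.reindex_bij_betw bij_betw_register_set)
  also have "{..<2 * L + 1} = insert 0 ({1..L} \<union> {1 + L..L + L})" by auto
  also have "(\<Sum>c\<in>\<dots>. \<Sum>S\<in>Pow {1..n}. h c S)
      = (\<Sum>S\<in>Pow {1..n}. h 0 S) + ((\<Sum>c=1..L. \<Sum>S\<in>Pow {1..n}. h c S) + (\<Sum>c=1 + L..L + L. \<Sum>S\<in>Pow {1..n}. h c S))"
    by (simp add: sum.union_disjoint)
  also have "(\<Sum>c=1 + L..L + L. \<Sum>S\<in>Pow {1..n}. h c S) = (\<Sum>i=1..L. \<Sum>S\<in>Pow {1..n}. h (i + L) S)"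
    by (rule sum.shift_bounds_cl_nat_ivl)
  finally show ?thesis by (simp add: add.assoc)
qed

lemma cscalar_prod_layered:
  "layered_vec n L u F G \<bullet>c layered_vec n L u' F' G' = of_real (u * u'
    + (\<Sum>i=1..L. \<Sum>S\<in>Pow {1..n}. F i S * F' i S) + (\<Sum>i=1..L. \<Sum>S\<in>Pow {1..n}. G i S * G' i S))"
proof -
  define h where "h c S = (if c = 0 then if S = {} then u * u' else 0
    else if c \<le> L then F c S * F' c S else G (c - L) S * G' (c - L) S)" for c S
  have "layered_vec n L u F G \<bullet>c layered_vec n L u' F' G'
      = (\<Sum>j<2 ^ n * (2 * L + 1). of_real (h (j mod (2 * L + 1)) (register_set (j div (2 * L + 1)))))"
    by (subst cscalar_prod_sum[of _ "2 ^ n * (2 * L + 1)"])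
      (auto simp: layered_vec_def h_def Let_def intro!: sum.cong)
  also have "\<dots> = of_real ((\<Sum>S\<in>Pow {1..n}. h 0 S) + (\<Sum>i=1..L. \<Sum>S\<in>Pow {1..n}. h i S)
      + (\<Sum>i=1..L. \<Sum>S\<in>Pow {1..n}. h (i + L) S))"
    unfolding of_real_sum[symmetric] sum_layers ..
  also have "(\<Sum>S\<in>Pow {1..n}. h 0 S) = u * u'"
    by (simp add: h_def)
  also have "(\<Sum>i=1..L. \<Sum>S\<in>Pow {1..n}. h i S) = (\<Sum>i=1..L. \<Sum>S\<in>Pow {1..n}. F i S * F' i S)"
    by (intro sum.cong refl) (simp add: h_def)
  also have "(\<Sum>i=1..L. \<Sum>S\<in>Pow {1..n}. h (i + L) S) = (\<Sum>i=1..L. \<Sum>S\<in>Pow {1..n}. G i S * G' i S)"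
    by (intro sum.cong refl) (simp add: h_def)
  finally show ?thesis .
qed

lemma norm_sq_layered:
  "norm_sq (layered_vec n L u F G) = u\<^sup>2
    + (\<Sum>i=1..L. \<Sum>S\<in>Pow {1..n}. (F i S)\<^sup>2) + (\<Sum>i=1..L. \<Sum>S\<in>Pow {1..n}. (G i S)\<^sup>2)"
  using cscalar_prod_layered[of n L u F G u F G]
  unfolding cscalar_prod_self of_real_eq_iff by (simp add: power2_eq_square)

definition layer_sign :: "nat \<Rightarrow> nat \<Rightarrow> complex mat" where
  "layer_sign n L = diag_matrix (2 ^ n * (2 * L + 1)) (\<lambda>j. if j mod (2 * L + 1) \<le> L then 1 else - 1)"

lemma unitary_layer_sign: "unitary_matrix (2 ^ n * (2 * L + 1)) (layer_sign n L)"
  unfolding layer_sign_def by (rule unitary_diag_matrix) simp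

text \<open>The start component lives at S = {}, where a function with \<open>f {} = 0\<close>
  causes no sign; only the layers are affected.\<close>

lemma signed_oracle_layered:
  assumes "f {} = 0"
  shows "layer_sign n L *\<^sub>v (phase_oracle n (2 * L + 1) f *\<^sub>v layered_vec n L u F G)
    = layered_vec n L u (\<lambda>i S. (- 1) ^ f S * F i S) (\<lambda>i S. - ((- 1) ^ f S * G i S))"
proof -
  have "phase_oracle n (2 * L + 1) f *\<^sub>v layered_vec n L u F G \<in> carrier_vec (2 ^ n * (2 * L + 1))"
    using unitary_matrix_carrier[OF unitary_phase_oracle] layered_vec_carrier by (rule mult_mat_vec_carrier)
  note * = diag_matrix_mult_vec[OF this]
  show ?thesis
    unfolding layer_sign_def * 
    unfolding phase_oracle_diag diag_matrix_mult_vec[OF layered_vec_carrier]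
    by (rule eq_vecI) (auto simp: layered_vec_def Let_def assms)
qed

section \<open>Amplitudes of a single level\<close>

text \<open>Here q is the probability that an element stays outside S, and \<open>q ^ a\<close> is
  the probability that S misses a given set of size a. Dividing by it makes \<open>miss_amp\<close>
  a unit vector for sets of that size.\<close>

definition level_weight :: "nat \<Rightarrow> nat \<Rightarrow> real \<Rightarrow> nat set \<Rightarrow> real" where
  "level_weight n a q S = sqrt (bernoulli_weight n (1 - q) S / q ^ a)"

definition miss_amp :: "nat \<Rightarrow> nat \<Rightarrow> real \<Rightarrow> nat set \<Rightarrow> nat set \<Rightarrow> real" where
  "miss_amp n a q A S = (if A \<inter> S = {} then level_weight n a q S else 0)"

text \<open>The term \<open>0 ^ card (B \<inter> S)\<close> is the indicator of \<open>B \<inter> S = {}\<close>.\<close>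

definition hit_amp :: "nat \<Rightarrow> nat \<Rightarrow> real \<Rightarrow> real \<Rightarrow> nat set \<Rightarrow> nat set \<Rightarrow> real" where
  "hit_amp n a q x B S = level_weight n a q S * (x ^ card (B \<inter> S) - 0 ^ card (B \<inter> S))"

lemma level_weight_squared:
  assumes "0 < q" "q \<le> 1"
  shows "(level_weight n a q S)\<^sup>2 = bernoulli_weight n (1 - q) S / q ^ a"
  using assms bernoulli_weight_nonneg[of "1 - q" n S] by (simp add: level_weight_def)

text \<open>Two instances of \<open>sum_bernoulli_weight\<close>, at y = x and at y = 0; their
  common factor \<open>q ^ card A\<close> cancels against the normalisation.\<close>

lemma sum_miss_hit:
  assumes q: "0 < q" "q \<le> 1" and A: "A \<subseteq> {1..n}" and B: "B \<subseteq> {1..n}"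
  shows "(\<Sum>S\<in>Pow {1..n}. miss_amp n (card A) q A S * hit_amp n (card A) q x B S)
    = (q + (1 - q) * x) ^ card (B - A) - q ^ card (B - A)"
proof -
  have "miss_amp n (card A) q A S * hit_amp n (card A) q x B S
      = ((if A \<inter> S = {} then bernoulli_weight n (1 - q) S * x ^ card (B \<inter> S) else 0)
        - (if A \<inter> S = {} then bernoulli_weight n (1 - q) S * 0 ^ card (B \<inter> S) else 0)) / q ^ card A" for S
    using level_weight_squared[OF q, of n "card A" S]
    by (simp add: miss_amp_def hit_amp_def power2_eq_square mult.assoc[symmetric] right_diff_distrib
        diff_divide_distrib)
  then have "(\<Sum>S\<in>Pow {1..n}. miss_amp n (card A) q A S * hit_amp n (card A) q x B S)
      = (q ^ card A * (q + (1 - q) * x) ^ card (B - A) - q ^ card A * q ^ card (B - A)) / q ^ card A"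
    using sum_bernoulli_weight[OF A B, of "1 - q" x] sum_bernoulli_weight[OF A B, of "1 - q" 0]
    by (simp add: sum_divide_distrib[symmetric] sum_subtractf)
  then show ?thesis using q by (simp add: right_diff_distrib[symmetric])
qed

lemma sum_miss_squared:
  assumes q: "0 < q" "q \<le> 1" and A: "A \<subseteq> {1..n}"
  shows "(\<Sum>S\<in>Pow {1..n}. (miss_amp n (card A) q A S)\<^sup>2) = 1"
proof -
  have "(miss_amp n (card A) q A S)\<^sup>2
      = (if A \<inter> S = {} then bernoulli_weight n (1 - q) S * 1 ^ card ({} \<inter> S) else 0) / q ^ card A" for S
    using level_weight_squared[OF q, of n "card A" S] by (simp add: miss_amp_def)
  then show ?thesis
    using sum_bernoulli_weight[OF A, of "{}" "1 - q" 1] q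
    by (simp add: sum_divide_distrib[symmetric])
qed

text \<open>Dropping the cut-off at B \<inter> S = {} leaves an expectation of (x squared) ^ |B
  \<inter> S|. The exponent \<open>a\<close> is kept apart from \<open>card B\<close> because the
  amplitude is normalised for the other of the two sizes.\<close>

lemma sum_hit_squared_le:
  assumes q: "0 < q" "q \<le> 1" and B: "B \<subseteq> {1..n}"
  shows "(\<Sum>S\<in>Pow {1..n}. (hit_amp n a q x B S)\<^sup>2) \<le> (q + (1 - q) * x\<^sup>2) ^ card B / q ^ a"
proof -
  have "(hit_amp n a q x B S)\<^sup>2 \<le> bernoulli_weight n (1 - q) S * (x\<^sup>2) ^ card (B \<inter> S) / q ^ a" for S
  proof -
    have "(hit_amp n a q x B S)\<^sup>2
        = bernoulli_weight n (1 - q) S / q ^ a * ((x\<^sup>2) ^ card (B \<inter> S) - 0 ^ card (B \<inter> S))"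
      by (simp add: hit_amp_def power_mult_distrib level_weight_squared[OF q] power_minus_zero_power_squared)
    also have "\<dots> \<le> bernoulli_weight n (1 - q) S / q ^ a * (x\<^sup>2) ^ card (B \<inter> S)"
      using q by (intro mult_left_mono divide_nonneg_pos bernoulli_weight_nonneg) auto
    finally show ?thesis by simp
  qed
  then have "(\<Sum>S\<in>Pow {1..n}. (hit_amp n a q x B S)\<^sup>2)
      \<le> (\<Sum>S\<in>Pow {1..n}. bernoulli_weight n (1 - q) S * (x\<^sup>2) ^ card (B \<inter> S) / q ^ a)"
    by (intro sum_mono)
  also have "\<dots> = (q + (1 - q) * x\<^sup>2) ^ card B / q ^ a"
    using sum_bernoulli_weight_all[OF B, of "1 - q" "x\<^sup>2"] by (simp add: sum_divide_distrib[symmetric])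
  finally show ?thesis .
qed

section \<open>The unitary separating the two sizes\<close>

text \<open>The grid stays abstract: \<open>q_step\<close> is what bounds the contribution of each
  level to the squared lengths by 1 + exp 4. The scale \<epsilon> trades the distance of the fixed
  vectors from \<open>e\<close> against the length of \<eta>.\<close>

lemma exists_gap_unitary:
  fixes n k d L :: nat and q :: "nat \<Rightarrow> real" and \<epsilon> :: real
  defines "K \<equiv> 2 * L + 1"
  defines "e \<equiv> unit_vec (2 ^ n * K) 0"
  assumes d: "d > 0" and L: "L > 0" and \<epsilon>: "\<epsilon> > 0" and q0: "q 0 = 1"
    and q_pos: "\<And>i. i \<in> {1..L} \<Longrightarrow> q i > 0" and q_less: "\<And>i. i \<in> {1..L} \<Longrightarrow> q i < 1"
    and q_min: "\<And>i. i \<in> {1..L} \<Longrightarrow> q L \<le> q i"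
    and q_step: "\<And>i. i \<in> {1..L} \<Longrightarrow> (q (i - 1) - q i)\<^sup>2 \<le> 4 / real (k + d) * ((1 - q i) * q i)"
  shows "\<exists>M. unitary_matrix (2 ^ n * K) M \<and>
    (\<forall>A \<in> size_family n k. \<exists>\<psi> \<in> carrier_vec (2 ^ n * K).
       (M * phase_oracle n K (intersects A)) *\<^sub>v \<psi> = \<psi> \<and>
       norm_sq (e - \<psi>) \<le> \<epsilon>\<^sup>2 * (real L * (1 + exp 4))) \<and>
    (\<forall>B \<in> size_family n (k + d). \<exists>\<eta> \<in> carrier_vec (2 ^ n * K).
       \<eta> - (M * phase_oracle n K (intersects B)) *\<^sub>v \<eta> = 2 \<cdot>\<^sub>v e \<and>
       norm_sq \<eta> \<le> 1 + (real L * (1 + exp 4)) / (\<epsilon> * (1 - q L ^ d))\<^sup>2)"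
proof -
  define N where "N = 2 ^ n * K"
  define \<kappa> where "\<kappa> = real L * (1 + exp 4)"
  define \<rho> where "\<rho> = q L ^ d"
  define \<gamma> where "\<gamma> = 1 - \<rho>"
  have LL: "L \<in> {1..L}" using L by simp
  have \<rho>: "0 < \<rho>" "\<rho> < 1"
    using q_pos[OF LL] q_less[OF LL] d by (auto simp: \<rho>_def power_less_one_iff)
  have \<gamma>: "\<gamma> > 0" using \<rho> by (simp add: \<gamma>_def)
  define x where "x i = (q (i - 1) - q i) / (1 - q i)" for i
  have qx: "q i + (1 - q i) * x i = q (i - 1)" if "i \<in> {1..L}" for i
    using q_less[OF that] by (simp add: x_def)
  \<comment> \<open>The quotient of the bases is 1 + (q (i - 1) - q i)^2 / ((1 - q i) q i), at most
    1 + 4 / (k + d) by \<open>q_step\<close>; up to k + d factors then stay below exp 4.\<close>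
  have bound: "(q i + (1 - q i) * (x i)\<^sup>2) ^ j / q i ^ j \<le> exp 4" if i: "i \<in> {1..L}" and j: "j \<le> k + d" for i j
  proof -
    have "(1 - q i) * (x i)\<^sup>2 = (q (i - 1) - q i)\<^sup>2 / (1 - q i)"
      using q_less[OF i] by (simp add: x_def power2_eq_square)
    also have "\<dots> \<le> 4 / real (k + d) * ((1 - q i) * q i) / (1 - q i)"
      using q_less[OF i] by (intro divide_right_mono q_step[OF i]) simp
    also have "\<dots> = 4 / real (k + d) * q i"
      using q_less[OF i] by simp
    finally have z: "(q i + (1 - q i) * (x i)\<^sup>2) / q i \<le> 1 + 4 / real (k + d)"
      using q_pos[OF i] by (simp add: field_simps)
    also have "\<dots> \<le> exp (4 / real (k + d))" by (rule exp_ge_add_one_self)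
    finally have "((q i + (1 - q i) * (x i)\<^sup>2) / q i) ^ j \<le> exp (4 / real (k + d)) ^ j"
      by (rule power_mono) (use q_pos[OF i] q_less[OF i] in \<open>auto intro!: divide_nonneg_pos add_nonneg_nonneg\<close>)
    also have "\<dots> = exp (real j * (4 / real (k + d)))"
      by (rule exp_of_nat_mult[symmetric])
    also have "real j * (4 / real (k + d)) \<le> 4"
      using j d by (simp add: field_simps)
    finally show ?thesis by (simp add: power_divide)
  qed
  \<comment> \<open>\<open>F\<close> pairs with \<open>F'\<close> and \<open>G\<close> with
    \<open>G'\<close>, always a miss against a hit. The scale \<epsilon> cancels in these products,
    and \<gamma> is the value of the telescoped difference, so the layers of \<psi> and \<eta> have
    inner product exactly 1.\<close>
  define F where "F A i S = \<epsilon> * miss_amp n k (q i) A S" for A i S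
  define G where "G A i S = - (\<epsilon> * \<rho>) * hit_amp n (k + d) (q i) (x i) A S" for A i S
  define F' where "F' B i S = hit_amp n k (q i) (x i) B S / (\<epsilon> * \<gamma>)" for B i S
  define G' where "G' B i S = miss_amp n (k + d) (q i) B S / (\<epsilon> * \<gamma>)" for B i S
  define \<psi> where "\<psi> A = layered_vec n L 1 (F A) (G A)" for A
  define \<eta> where "\<eta> B = layered_vec n L 1 (F' B) (G' B)" for B
  \<comment> \<open>The image of \<eta> under the query and \<open>layer_sign\<close>: the start
    component stays and all layers change sign. Its inner product with each \<psi> is therefore 1 -
    1 = 0.\<close>
  define \<xi> where "\<xi> B = layered_vec n L 1 (\<lambda>i S. - F' B i S) (\<lambda>i S. - G' B i S)" for B
  have carr: "\<psi> A \<in> carrier_vec N" "\<eta> A \<in> carrier_vec N" "\<xi> A \<in> carrier_vec N" for A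
    by (simp_all only: \<psi>_def \<eta>_def \<xi>_def N_def K_def layered_vec_carrier)
  have telescope: "(\<Sum>i=1..L. q (i - 1) ^ r - q i ^ r) = 1 - q L ^ r" for r
    using sum_telescope''[of 0 L "\<lambda>i. - (q i ^ r)"] q0 by (simp add: atLeastSucAtMost_greaterThanAtMost)
  have orth: "\<xi> B \<bullet>c \<psi> A = 0" if A: "A \<in> size_family n k" and B: "B \<in> size_family n (k + d)" for A B
  proof -
    have A': "A \<subseteq> {1..n}" "card A = k" and B': "B \<subseteq> {1..n}" "card B = k + d"
      using A B by (auto simp: size_family_def)
    have fin: "finite A" "finite B" using A' B' finite_subset by auto
    define l where "l = card (A - B)"
    have r: "card (B - A) = l + d"
    proof -
      have "card (A - B) + card (A \<inter> B) = card A" "card (B - A) + card (A \<inter> B) = card B"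
        using fin by (metis card_Diff_subset_Int card_Int_Diff add.commute Int_commute)+
      then show ?thesis using A' B' by (simp add: l_def)
    qed
    have "(\<Sum>S\<in>Pow {1..n}. - F' B i S * F A i S) = - (1 / \<gamma>) * (q (i - 1) ^ (l + d) - q i ^ (l + d))"
      if i: "i \<in> {1..L}" for i
    proof -
      have "- F' B i S * F A i S = - (1 / \<gamma>) * (miss_amp n k (q i) A S * hit_amp n k (q i) (x i) B S)" for S
        using \<epsilon> by (simp add: F_def F'_def)
      then have "(\<Sum>S\<in>Pow {1..n}. - F' B i S * F A i S)
          = - (1 / \<gamma>) * (\<Sum>S\<in>Pow {1..n}. miss_amp n k (q i) A S * hit_amp n k (q i) (x i) B S)"
        by (simp only: sum_distrib_left)
      then show ?thesis
        using sum_miss_hit[of "q i" A n B "x i"] q_pos[OF i] q_less[OF i] A' B' r qx[OF i] by simp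
    qed
    then have "(\<Sum>i=1..L. \<Sum>S\<in>Pow {1..n}. - F' B i S * F A i S)
        = (\<Sum>i=1..L. - (1 / \<gamma>) * (q (i - 1) ^ (l + d) - q i ^ (l + d)))"
      by (rule sum.cong[OF refl])
    then have 1: "(\<Sum>i=1..L. \<Sum>S\<in>Pow {1..n}. - F' B i S * F A i S) = - (1 / \<gamma>) * (1 - q L ^ (l + d))"
      by (simp only: sum_distrib_left[symmetric] telescope)
    have "(\<Sum>S\<in>Pow {1..n}. - G' B i S * G A i S) = \<rho> / \<gamma> * (q (i - 1) ^ l - q i ^ l)"
      if i: "i \<in> {1..L}" for i
    proof -
      have "- G' B i S * G A i S = \<rho> / \<gamma> * (miss_amp n (k + d) (q i) B S * hit_amp n (k + d) (q i) (x i) A S)" for S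
        using \<epsilon> by (simp add: G_def G'_def)
      then have "(\<Sum>S\<in>Pow {1..n}. - G' B i S * G A i S)
          = \<rho> / \<gamma> * (\<Sum>S\<in>Pow {1..n}. miss_amp n (k + d) (q i) B S * hit_amp n (k + d) (q i) (x i) A S)"
        by (simp only: sum_distrib_left)
      then show ?thesis
        using sum_miss_hit[of "q i" B n A "x i"] q_pos[OF i] q_less[OF i] A' B' qx[OF i]
        by (simp add: l_def)
    qed
    then have "(\<Sum>i=1..L. \<Sum>S\<in>Pow {1..n}. - G' B i S * G A i S)
        = (\<Sum>i=1..L. \<rho> / \<gamma> * (q (i - 1) ^ l - q i ^ l))"
      by (rule sum.cong[OF refl])
    then have 2: "(\<Sum>i=1..L. \<Sum>S\<in>Pow {1..n}. - G' B i S * G A i S) = \<rho> / \<gamma> * (1 - q L ^ l)"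
      by (simp only: sum_distrib_left[symmetric] telescope)
    \<comment> \<open>The dependence on l, hence on the overlap of A and B, cancels because \<rho>
      times \<open>q L ^ l\<close> is \<open>q L ^ (l + d)\<close>.\<close>
    have "1 + - (1 / \<gamma>) * (1 - q L ^ (l + d)) + \<rho> / \<gamma> * (1 - q L ^ l) = 0"
      using \<gamma> by (simp add: \<gamma>_def \<rho>_def field_simps power_add)
    then show ?thesis
      unfolding \<xi>_def \<psi>_def cscalar_prod_layered 1 2 by simp
  qed
  have fin: "finite (size_family n k)"
    by (rule finite_subset[of _ "Pow {1..n}"]) (auto simp: size_family_def)
  then obtain vs where vs: "set vs = \<psi> ` size_family n k"
    using finite_list[of "\<psi> ` size_family n k"] by auto
  \<comment> \<open>The vectors of all sets of size k enter at once, so \<open>R\<close> and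
    \<open>M\<close> are independent of the hidden set.\<close>
  then obtain R where R: "unitary_matrix N R" and fixR: "\<And>A. A \<in> size_family n k \<Longrightarrow> R *\<^sub>v \<psi> A = \<psi> A"
    and flipR: "\<And>z. z \<in> carrier_vec N \<Longrightarrow> (\<forall>A \<in> size_family n k. z \<bullet>c \<psi> A = 0) \<Longrightarrow> R *\<^sub>v z = - z"
    using exists_reflection[of vs N] carr by (auto simp: image_subset_iff)
  define M where "M = R * layer_sign n L"
  have Z: "unitary_matrix N (layer_sign n L)"
    unfolding N_def K_def by (rule unitary_layer_sign)
  have M: "unitary_matrix N M" unfolding M_def by (rule unitary_matrix_mult[OF R Z])
  have step: "(M * phase_oracle n K (intersects A)) *\<^sub>v layered_vec n L u f g
      = R *\<^sub>v layered_vec n L u (\<lambda>i S. (- 1) ^ intersects A S * f i S) (\<lambda>i S. - ((- 1) ^ intersects A S * g i S))"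
    for A u f g
  proof -
    have v: "layered_vec n L u f g \<in> carrier_vec N" by (simp only: N_def K_def layered_vec_carrier)
    have O: "phase_oracle n K (intersects A) \<in> carrier_mat N N"
      using unitary_matrix_carrier[OF unitary_phase_oracle] by (simp add: N_def)
    have "(M * phase_oracle n K (intersects A)) *\<^sub>v layered_vec n L u f g
        = R *\<^sub>v (layer_sign n L *\<^sub>v (phase_oracle n K (intersects A) *\<^sub>v layered_vec n L u f g))"
      unfolding M_def assoc_mult_mat_vec[OF mult_carrier_mat[OF unitary_matrix_carrier[OF R] unitary_matrix_carrier[OF Z]] O v]
      by (rule assoc_mult_mat_vec[OF unitary_matrix_carrier[OF R] unitary_matrix_carrier[OF Z] mult_mat_vec_carrier[OF O v]])
    also have "\<dots> = R *\<^sub>v layered_vec n L u (\<lambda>i S. (- 1) ^ intersects A S * f i S) (\<lambda>i S. - ((- 1) ^ intersects A S * g i S))"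
      unfolding K_def by (subst signed_oracle_layered) (auto simp: intersects_def)
    finally show ?thesis .
  qed
  have e_layered: "e = layered_vec n L 1 (\<lambda>_ _. 0) (\<lambda>_ _. 0)"
  proof (rule eq_vecI)
    fix j assume "j < dim_vec (layered_vec n L 1 (\<lambda>_ _. 0) (\<lambda>_ _. 0))"
    then have j: "j < 2 ^ n * (2 * L + 1)" by (simp add: layered_vec_def)
    have "j div (2 * L + 1) < 2 ^ n" using j by (simp only: less_mult_imp_div_less)
    then have "register_set (j div (2 * L + 1)) = {} \<longleftrightarrow> j div (2 * L + 1) = 0"
      using inj_onD[OF bij_betw_imp_inj_on[OF bij_betw_register_set[of n]], of "j div (2 * L + 1)" 0] by auto
    moreover have "j = 0 \<longleftrightarrow> j div (2 * L + 1) = 0 \<and> j mod (2 * L + 1) = 0"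
      by (metis div_mult_mod_eq div_0 mod_0 mult_0 add_0)
    ultimately show "e $ j = layered_vec n L 1 (\<lambda>_ _. 0) (\<lambda>_ _. 0) $ j"
      using j by (auto simp: e_def K_def layered_vec_def Let_def)
  qed (simp add: e_def K_def layered_vec_def)
  have fixed: "(M * phase_oracle n K (intersects A)) *\<^sub>v \<psi> A = \<psi> A" if A: "A \<in> size_family n k" for A
  proof -
    \<comment> \<open>\<open>F A\<close> lives where S misses A and \<open>G A\<close> where S meets
      A. With the reversed sign on the second direction, neither changes.\<close>
    have "(\<lambda>i S. (- 1) ^ intersects A S * F A i S) = F A"
      by (intro ext) (auto simp: F_def miss_amp_def intersects_def)
    moreover have "(\<lambda>i S. - ((- 1) ^ intersects A S * G A i S)) = G A"
      by (intro ext) (auto simp: G_def hit_amp_def intersects_def)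
    ultimately show ?thesis
      using step[of A 1 "F A" "G A"] fixR[OF A] by (simp add: \<psi>_def)
  qed
  have flipped: "\<eta> B - (M * phase_oracle n K (intersects B)) *\<^sub>v \<eta> B = 2 \<cdot>\<^sub>v e"
    if B: "B \<in> size_family n (k + d)" for B
  proof -
    \<comment> \<open>Here the supports are exchanged, so both directions change sign.\<close>
    have "(\<lambda>i S. (- 1) ^ intersects B S * F' B i S) = (\<lambda>i S. - F' B i S)"
      by (intro ext) (auto simp: F'_def hit_amp_def intersects_def)
    moreover have "(\<lambda>i S. - ((- 1) ^ intersects B S * G' B i S)) = (\<lambda>i S. - G' B i S)"
      by (intro ext) (auto simp: G'_def miss_amp_def intersects_def)
    ultimately have "(M * phase_oracle n K (intersects B)) *\<^sub>v \<eta> B = - \<xi> B"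
      using step[of B 1 "F' B" "G' B"] flipR[OF carr(3)] orth[OF _ B] by (simp add: \<eta>_def \<xi>_def)
    moreover have "\<eta> B - (- \<xi> B) = 2 \<cdot>\<^sub>v e"
      unfolding e_layered \<eta>_def \<xi>_def by (rule eq_vecI) (auto simp: layered_vec_def Let_def)
    ultimately show ?thesis by simp
  qed
  have level_sum: "(\<Sum>i=1..L. h i) + (\<Sum>i=1..L. h' i) \<le> \<kappa>"
    if "\<And>i. i \<in> {1..L} \<Longrightarrow> h i \<le> 1" "\<And>i. i \<in> {1..L} \<Longrightarrow> h' i \<le> exp 4" for h h' :: "nat \<Rightarrow> real"
    using sum_bounded_above[of "{1..L}" h 1] sum_bounded_above[of "{1..L}" h' "exp 4"] that
    by (simp add: \<kappa>_def algebra_simps)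
  have near: "norm_sq (e - \<psi> A) \<le> \<epsilon>\<^sup>2 * \<kappa>" if A: "A \<in> size_family n k" for A
  proof -
    have A': "A \<subseteq> {1..n}" "card A = k" using A by (auto simp: size_family_def)
    define H where "H i S = \<rho> * hit_amp n (k + d) (q i) (x i) A S" for i S
    have "e - \<psi> A = layered_vec n L 0 (\<lambda>i S. - F A i S) (\<lambda>i S. - G A i S)"
      unfolding e_layered \<psi>_def by (rule eq_vecI) (auto simp: layered_vec_def Let_def)
    then have "norm_sq (e - \<psi> A) = (\<Sum>i=1..L. \<Sum>S\<in>Pow {1..n}. (F A i S)\<^sup>2) + (\<Sum>i=1..L. \<Sum>S\<in>Pow {1..n}. (G A i S)\<^sup>2)"
      by (simp add: norm_sq_layered)
    also have "\<dots> = \<epsilon>\<^sup>2 * ((\<Sum>i=1..L. \<Sum>S\<in>Pow {1..n}. (miss_amp n k (q i) A S)\<^sup>2)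
        + (\<Sum>i=1..L. \<Sum>S\<in>Pow {1..n}. (H i S)\<^sup>2))"
      by (simp add: F_def G_def H_def power_mult_distrib sum_distrib_left[symmetric] algebra_simps)
    also have "\<dots> \<le> \<epsilon>\<^sup>2 * \<kappa>"
    proof (intro mult_left_mono level_sum)
      fix i assume i: "i \<in> {1..L}"
      have qi: "0 < q i" "q i \<le> 1" using q_pos[OF i] q_less[OF i] by auto
      show "(\<Sum>S\<in>Pow {1..n}. (miss_amp n k (q i) A S)\<^sup>2) \<le> 1"
        using sum_miss_squared[OF qi A'(1)] A' by simp
      \<comment> \<open>The hit amplitudes of A are normalised for size k + d although A has size k.
        The excess factor 1 / q_i^d is paid for by the factor \<rho> in \<open>G\<close>.\<close>
      have "\<rho>\<^sup>2 \<le> \<rho>" using \<rho> by (simp add: power2_eq_square)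
      also have "\<rho> \<le> q i ^ d" unfolding \<rho>_def using q_min[OF i] q_pos[OF LL] by (intro power_mono) auto
      finally have \<rho>2: "\<rho>\<^sup>2 \<le> q i ^ d" .
      have nn: "0 \<le> (q i + (1 - q i) * (x i)\<^sup>2) ^ k / q i ^ (k + d)"
        using qi by simp
      have "(\<Sum>S\<in>Pow {1..n}. (H i S)\<^sup>2) = \<rho>\<^sup>2 * (\<Sum>S\<in>Pow {1..n}. (hit_amp n (k + d) (q i) (x i) A S)\<^sup>2)"
        by (simp add: H_def power_mult_distrib sum_distrib_left)
      also have "\<dots> \<le> \<rho>\<^sup>2 * ((q i + (1 - q i) * (x i)\<^sup>2) ^ k / q i ^ (k + d))"
        using sum_hit_squared_le[OF qi A'(1)] A'(2) by (intro mult_left_mono) auto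
      also have "\<dots> \<le> q i ^ d * ((q i + (1 - q i) * (x i)\<^sup>2) ^ k / q i ^ (k + d))"
        by (rule mult_right_mono[OF \<rho>2 nn])
      also have "\<dots> = (q i + (1 - q i) * (x i)\<^sup>2) ^ k / q i ^ k"
        using qi by (simp add: power_add)
      also have "\<dots> \<le> exp 4" by (rule bound[OF i]) simp
      finally show "(\<Sum>S\<in>Pow {1..n}. (H i S)\<^sup>2) \<le> exp 4" .
    qed simp
    finally show ?thesis .
  qed
  have small: "norm_sq (\<eta> B) \<le> 1 + \<kappa> / (\<epsilon> * \<gamma>)\<^sup>2" if B: "B \<in> size_family n (k + d)" for B
  proof -
    have B': "B \<subseteq> {1..n}" "card B = k + d" using B by (auto simp: size_family_def)
    have "norm_sq (\<eta> B) = 1 + ((\<Sum>i=1..L. \<Sum>S\<in>Pow {1..n}. (miss_amp n (k + d) (q i) B S)\<^sup>2)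
        + (\<Sum>i=1..L. \<Sum>S\<in>Pow {1..n}. (hit_amp n k (q i) (x i) B S)\<^sup>2)) / (\<epsilon> * \<gamma>)\<^sup>2"
      by (simp add: \<eta>_def norm_sq_layered F'_def G'_def power_divide sum_divide_distrib[symmetric] add_divide_distrib)
    also have "\<dots> \<le> 1 + \<kappa> / (\<epsilon> * \<gamma>)\<^sup>2"
    proof (intro add_left_mono divide_right_mono level_sum)
      fix i assume i: "i \<in> {1..L}"
      have qi: "0 < q i" "q i \<le> 1" using q_pos[OF i] q_less[OF i] by auto
      show "(\<Sum>S\<in>Pow {1..n}. (miss_amp n (k + d) (q i) B S)\<^sup>2) \<le> 1"
        using sum_miss_squared[OF qi B'(1)] B' by simp
      have nn: "0 \<le> (q i + (1 - q i) * (x i)\<^sup>2) ^ (k + d)"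
        using qi by simp
      have "(\<Sum>S\<in>Pow {1..n}. (hit_amp n k (q i) (x i) B S)\<^sup>2) \<le> (q i + (1 - q i) * (x i)\<^sup>2) ^ (k + d) / q i ^ k"
        using sum_hit_squared_le[OF qi B'(1)] B'(2) by simp
      \<comment> \<open>In this direction the normalisation is too weak rather than too strong, and
        q_i \<le> 1 allows raising the exponent to match \<open>bound\<close>.\<close>
      also have "\<dots> \<le> (q i + (1 - q i) * (x i)\<^sup>2) ^ (k + d) / q i ^ (k + d)"
        using qi nn by (intro divide_left_mono power_decreasing) auto
      also have "\<dots> \<le> exp 4" by (rule bound[OF i]) simp
      finally show "(\<Sum>S\<in>Pow {1..n}. (hit_amp n k (q i) (x i) B S)\<^sup>2) \<le> exp 4" .
    qed simp
    finally show ?thesis .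
  qed
  show ?thesis
    using M fixed flipped near small carr
    unfolding N_def[symmetric] \<kappa>_def[symmetric] \<rho>_def[symmetric] \<gamma>_def[symmetric] by blast
qed

section \<open>Choice of the parameters\<close>

text \<open>With \<epsilon> squared of order 1 / L, the fixed vectors are within a constant distance
  of \<open>e\<close> while \<eta> has length O(L). Averaging over \<open>L * D\<close> powers, with
  a constant \<open>D\<close>, then separates the two sizes.\<close>

lemma EGGT_algorithm:
  fixes n k d :: nat
  assumes d: "d > 0"
  defines "L \<equiv> nat \<lfloor>sqrt (1 + real k / real d)\<rfloor>"
  defines "D \<equiv> nat \<lceil>2 + 81 * (1 + exp 4 :: real)\<rceil>"
  shows "\<exists>Q. quantum_query_algorithm n Q \<and> solves_EGGT n k d Q \<and> num_queries Q = L * D + 1"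
proof -
  define m where "m = real (k + d)"
  have m: "m \<ge> 1" using d by (simp add: m_def)
  define s where "s = sqrt (1 + real k / real d)"
  have s2: "s\<^sup>2 = m / real d" using d by (simp add: s_def m_def field_simps)
  have s1: "s \<ge> 1" by (simp add: s_def)
  \<comment> \<open>Rounding down costs at most a factor 2, since s \<ge> 1 gives s < L + 1 \<le> 2
    L.\<close>
  have Ls: "real L \<le> s" "s \<le> 2 * real L" and L: "L > 0"
  proof -
    have L_floor: "real L = of_int \<lfloor>s\<rfloor>" using s1 by (simp add: L_def s_def)
    have "real L \<ge> 1" using s1 unfolding L_floor by simp
    then show "real L \<le> s" "s \<le> 2 * real L" "L > 0"
      using of_int_floor_le[of s] real_of_int_floor_add_one_gt[of s] unfolding L_floor[symmetric]
      by linarith+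
  qed
  have L_upper: "(real L)\<^sup>2 * real d \<le> m"
  proof -
    have "(real L)\<^sup>2 \<le> s\<^sup>2" using Ls by (intro power_mono) auto
    then show ?thesis using d by (simp add: s2 field_simps)
  qed
  have L_lower: "m \<le> 4 * ((real L)\<^sup>2 * real d)"
  proof -
    have "s\<^sup>2 \<le> (2 * real L)\<^sup>2" using Ls s1 by (intro power_mono) auto
    then show ?thesis using d unfolding s2 by (simp add: field_simps power2_eq_square)
  qed
  have L_le: "(real L)\<^sup>2 \<le> m"
    using L_upper d mult_left_mono[of 1 "real d" "(real L)\<^sup>2"] by simp
  \<comment> \<open>On a quadratic grid the squared step is of order i^2 / m^2, as is (1 - q_i) / m,
    which is what \<open>q_step\<close> compares. \<open>L_le\<close> keeps every value at least 1 /
    2.\<close>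
  define q :: "nat \<Rightarrow> real" where "q i = 1 - (real i)\<^sup>2 / (2 * m)" for i
  have q_half: "q i \<ge> 1 / 2" if "i \<in> {1..L}" for i
  proof -
    have "(real i)\<^sup>2 \<le> (real L)\<^sup>2" using that by (intro power_mono) auto
    then have "(real i)\<^sup>2 \<le> m" using L_le by (rule order_trans)
    then show ?thesis using m by (simp add: q_def field_simps)
  qed
  have q_less: "q i < 1" if "i \<in> {1..L}" for i
    using that m by (simp add: q_def)
  have q_min: "q L \<le> q i" if "i \<in> {1..L}" for i
    using that m by (simp add: q_def divide_right_mono)
  have q_step: "(q (i - 1) - q i)\<^sup>2 \<le> 4 / real (k + d) * ((1 - q i) * q i)" if i: "i \<in> {1..L}" for i
  proof -
    have "q (i - 1) - q i = (2 * real i - 1) / (2 * m)"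
      using i m by (simp add: q_def of_nat_diff field_simps power2_eq_square)
    then have "(q (i - 1) - q i)\<^sup>2 = (2 * real i - 1)\<^sup>2 / (4 * m\<^sup>2)"
      by (simp add: power_divide power_mult_distrib)
    also have "\<dots> \<le> (2 * real i)\<^sup>2 / (4 * m\<^sup>2)"
      using i by (intro divide_right_mono power_mono) auto
    also have "\<dots> = 4 / m * ((1 - q i) * (1 / 2))"
      using m by (simp add: q_def field_simps power2_eq_square)
    also have "\<dots> \<le> 4 / m * ((1 - q i) * q i)"
      using m q_half[OF i] q_less[OF i] by (intro mult_left_mono) auto
    finally show ?thesis by (simp add: m_def)
  qed
  have LL: "L \<in> {1..L}" using L by simp
  define \<gamma> where "\<gamma> = 1 - q L ^ d"
  \<comment> \<open>With p = 1 - q_L, \<open>L_lower\<close> gives d p \<ge> 1 / 8, so (1 + p)^d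
    \<ge> 9 / 8 by Bernoulli. As (1 - p)(1 + p) \<le> 1, it follows that q_L^d \<le> 8 / 9.\<close>
  have \<gamma>: "\<gamma> \<ge> 1 / 9"
  proof -
    define p where "p = 1 - q L"
    have p: "0 \<le> p" "p \<le> 1" using q_half[OF LL] q_less[OF LL] by (auto simp: p_def)
    have "real d * p \<ge> 1 / 8"
      using L_lower m by (simp add: p_def q_def field_simps)
    then have "9 / 8 \<le> (1 + p) ^ d"
      using Bernoulli_inequality[of p d] p by simp
    then have "q L ^ d * (9 / 8) \<le> q L ^ d * (1 + p) ^ d"
      using q_half[OF LL] by (intro mult_left_mono) auto
    also have "\<dots> = (1 - p\<^sup>2) ^ d"
      by (simp add: p_def power_mult_distrib[symmetric] power2_eq_square algebra_simps)
    also have "\<dots> \<le> 1"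
      using p by (intro power_le_one) (auto simp: power_le_one)
    finally show ?thesis by (simp add: \<gamma>_def)
  qed
  define \<kappa> :: real where "\<kappa> = 1 + exp 4"
  have \<kappa>: "\<kappa> > 1" by (simp add: \<kappa>_def)
  \<comment> \<open>The 20 makes the squared distance at most 1 / 20, hence the amplitude at least 1
    - 2 / 20 = 9 / 10, whose square 81 / 100 exceeds 2 / 3.\<close>
  define \<epsilon> where "\<epsilon> = sqrt (1 / (20 * (real L * \<kappa>)))"
  have \<epsilon>: "\<epsilon> > 0" "\<epsilon>\<^sup>2 = 1 / (20 * (real L * \<kappa>))"
    using L \<kappa> by (auto simp: \<epsilon>_def)
  define K where "K = 2 * L + 1"
  define N where "N = 2 ^ n * K"
  define e :: "complex vec" where "e = unit_vec N 0"
  have N: "N > 0" by (simp add: N_def K_def)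
  obtain M where M: "unitary_matrix N M"
    and X: "\<forall>A \<in> size_family n k. \<exists>\<psi> \<in> carrier_vec N.
       (M * phase_oracle n K (intersects A)) *\<^sub>v \<psi> = \<psi> \<and> norm_sq (e - \<psi>) \<le> \<epsilon>\<^sup>2 * (real L * \<kappa>)"
    and Y: "\<forall>B \<in> size_family n (k + d). \<exists>\<eta> \<in> carrier_vec N.
       \<eta> - (M * phase_oracle n K (intersects B)) *\<^sub>v \<eta> = 2 \<cdot>\<^sub>v e \<and>
       norm_sq \<eta> \<le> 1 + (real L * \<kappa>) / (\<epsilon> * \<gamma>)\<^sup>2"
    using exists_gap_unitary[OF d L \<epsilon>(1), of q k n] q_half q_less q_min q_step
    unfolding K_def[symmetric] N_def[symmetric] e_def[symmetric] \<kappa>_def[symmetric] \<gamma>_def[symmetric]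
    by (force simp: q_def)
  have D: "real D \<ge> 2 + 81 * \<kappa>" by (simp add: D_def \<kappa>_def)
  define T where "T = L * D"
  have T: "T > 0" using L D \<kappa> by (cases D) (auto simp: T_def)
  have U: "unitary_matrix N (M * phase_oracle n K f)" for f
    using unitary_matrix_mult[OF M] unitary_phase_oracle[of n K f] by (simp add: N_def)
  define z where "z f = (\<Sum>t<T. mat_iter (M * phase_oracle n K f) t e $ 0) / of_nat T" for f
  obtain Q where Q: "quantum_query_algorithm n Q" "num_queries Q = T + 1"
    and prob: "\<And>f. f {} = 0 \<Longrightarrow> answer_prob n Q f False = (cmod (z f))\<^sup>2 \<and> answer_prob n Q f True = 1 - (cmod (z f))\<^sup>2"
    using averaging_algorithm[of n K M T] M T unfolding N_def[symmetric] e_def[symmetric] z_def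
    by (auto simp: K_def)
  have i0: "intersects A {} = 0" for A by (simp add: intersects_def)
  have "answer_prob n Q (intersects A) False \<ge> 2 / 3" if A: "A \<in> size_family n k" for A
  proof -
    obtain \<psi> where \<psi>: "\<psi> \<in> carrier_vec N" "(M * phase_oracle n K (intersects A)) *\<^sub>v \<psi> = \<psi>"
      and close: "norm_sq (e - \<psi>) \<le> \<epsilon>\<^sup>2 * (real L * \<kappa>)"
      using X A by blast
    have "norm_sq (e - \<psi>) \<le> 1 / 20" using close L \<kappa> by (simp add: \<epsilon>(2))
    then have ge: "9 / 10 \<le> Re (mat_iter (M * phase_oracle n K (intersects A)) t e $ 0)" for t
      using near_fixpoint_amplitude[OF U N \<psi>, of t] by (simp add: e_def)
    have "real T * (9 / 10) \<le> (\<Sum>t<T. Re (mat_iter (M * phase_oracle n K (intersects A)) t e $ 0))"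
      using sum_bounded_below[of "{..<T}" "9 / 10", OF ge] by simp
    then have "9 / 10 \<le> Re (z (intersects A))"
      using T by (simp add: z_def Re_divide_of_nat field_simps)
    also have "\<dots> \<le> cmod (z (intersects A))" by (rule complex_Re_le_cmod)
    finally have "(9 / 10)\<^sup>2 \<le> (cmod (z (intersects A)))\<^sup>2" by (intro power_mono) auto
    then show ?thesis using prob[of "intersects A"] i0 by (simp add: power2_eq_square)
  qed
  moreover have "answer_prob n Q (intersects B) True \<ge> 2 / 3" if B: "B \<in> size_family n (k + d)" for B
  proof -
    obtain \<eta> where \<eta>: "\<eta> \<in> carrier_vec N"
        "\<eta> - (M * phase_oracle n K (intersects B)) *\<^sub>v \<eta> = 2 \<cdot>\<^sub>v e"
      and small: "norm_sq \<eta> \<le> 1 + (real L * \<kappa>) / (\<epsilon> * \<gamma>)\<^sup>2"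
      using Y B by blast
    have "(cmod (\<Sum>t<T. mat_iter (M * phase_oracle n K (intersects B)) t e $ 0))\<^sup>2 \<le> norm_sq \<eta>"
      using telescoping_amplitude[OF U N \<eta>(1)] \<eta>(2) by (simp add: e_def)
    also note small
    also have "1 + (real L * \<kappa>) / (\<epsilon> * \<gamma>)\<^sup>2 = 1 + 20 * (real L * \<kappa>)\<^sup>2 / \<gamma>\<^sup>2"
      unfolding power_mult_distrib[of \<epsilon>] \<epsilon>(2) using L \<kappa> \<gamma> by (simp add: power2_eq_square)
    also have "\<dots> \<le> (real L)\<^sup>2 + 20 * (real L * \<kappa>)\<^sup>2 / (1 / 9)\<^sup>2"
      using L \<gamma> by (intro add_mono divide_left_mono power_mono) auto
    also have "\<dots> = (real L)\<^sup>2 * (1 + 1620 * \<kappa>\<^sup>2)"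
      by (simp add: power2_eq_square algebra_simps)
    also have "\<dots> \<le> (real L)\<^sup>2 * ((real D)\<^sup>2 / 4)"
    proof (rule mult_left_mono)
      \<comment> \<open>The constant 1620 is 20 times 81, from \<epsilon> and from \<gamma> \<ge> 1
        / 9; four times it is 6480, just below the square of 81. The resulting 1 / 4 leaves success
        probability 3 / 4.\<close>
      have "4 * (1 + 1620 * \<kappa>\<^sup>2) \<le> (2 + 81 * \<kappa>)\<^sup>2"
        using \<kappa> by (simp add: power2_eq_square algebra_simps)
      also have "\<dots> \<le> (real D)\<^sup>2" using D \<kappa> by (intro power_mono) auto
      finally show "1 + 1620 * \<kappa>\<^sup>2 \<le> (real D)\<^sup>2 / 4" by simp
    qed simp
    also have "\<dots> = (real T)\<^sup>2 / 4" by (simp add: T_def power_mult_distrib)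
    finally have "(cmod (z (intersects B)))\<^sup>2 \<le> 1 / 4"
      using T by (simp add: z_def norm_divide power_divide field_simps)
    then show ?thesis using prob[of "intersects B"] i0 by simp
  qed
  ultimately show ?thesis using Q by (auto simp: solves_EGGT_def T_def)
qed

theorem theorem3p10:
  shows "\<exists>C::real. C > 0 \<and>
    (\<forall>k d n :: nat. k > 0 \<longrightarrow> d > 0 \<longrightarrow>
      (\<exists>Q. quantum_query_algorithm n Q \<and> solves_EGGT n k d Q \<and>
           real (num_queries Q) \<le> C * sqrt (1 + real k / real d)))"
proof -
  define D where "D = nat \<lceil>2 + 81 * (1 + exp 4 :: real)\<rceil>"
  have "\<exists>Q. quantum_query_algorithm n Q \<and> solves_EGGT n k d Q \<and>
      real (num_queries Q) \<le> (real D + 1) * sqrt (1 + real k / real d)" if d: "d > 0" for k d n :: nat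
  proof -
    define s where "s = sqrt (1 + real k / real d)"
    have s: "s \<ge> 1" by (simp add: s_def)
    have "real (nat \<lfloor>s\<rfloor> * D + 1) \<le> s * real D + 1"
      using s of_int_floor_le[of s] by (simp add: mult_right_mono)
    \<comment> \<open>The one additional query is absorbed because s \<ge> 1.\<close>
    also have "\<dots> \<le> (real D + 1) * s"
      using s by (simp add: algebra_simps)
    finally show ?thesis
      using EGGT_algorithm[OF d, of n k] unfolding D_def[symmetric] s_def[symmetric] by auto
  qed
  then show ?thesis
    by (intro exI[of _ "real D + 1"]) auto
qed

end
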